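(* Let $d\ge 2$ and let $K\subset\mathbb{R}^d$ be a convex body with $o\in\operatorname{int}K$ in which a ball (of some positive radius) rolls freely. Let $\varrho$ be a probability density function on $K$ (with respect to Lebesgue measure) such that $\varrho$ is positive and continuous at each boundary point of $K$. Let $K_{(n)}$ be the convex hull of $n$ independent random points in $K$, each with density $\varrho$. Then $$\operatorname{Var}_\varrho\bigl(W(K_{(n)})\bigr)\ll n^{-\frac{d+3}{d+1}},$$ where the implied constant depends only on $K$ and $\varrho$; that is, there is a constant $c>0$ depending only on $K$ and $\varrho$ such that $\operatorname{Var}_\varrho(W(K_{(n)}))\le c\,n^{-\frac{d+3}{d+1}}$ for all $n\in\mathbb{N}$.
   Context: A convex body is a compact convex set with nonempty interior in $\mathbb{R}^d$; $o$ is the origin. $\mathcal{H}^{d-1}$ is $(d-1)$-dimensional Hausdorff measure, $\kappa_d$ is the volume of the $d$-dimensional unit ball. A ball $B$ rolls freely inside $K$ if for each boundary point $p$ of $K$ there is a translate $B+v$ with $p\in B+v$ and $B+v\subset K$. For a nonempty compact convex set $M$, $h_M(u)=\max_{x\in M}\langle u,x\rangle$ is the support function and $W(M)=\frac{2}{d\kappa_d}\int_{S^{d-1}}h_M(u)\,\mathcal{H}^{d-1}(\mathrm{d}u)$ is the mean width. $\operatorname{Var}_\varrho$ denotes variance when the points are i.i.d. with density $\varrho$. *)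

theory Defs
  imports "HOL-Probability.Probability"
begin

text \<open>The weight of a covering set is normalised so that the \<open>n\<close>-dimensional Hausdorff measure on
  an \<open>n\<close>-dimensional Euclidean space is Lebesgue measure. The case distinction makes the empty set
  weightless also for \<open>s = 0\<close>.\<close>

definition hausdorff_weight :: "nat \<Rightarrow> 'a::metric_space set \<Rightarrow> ennreal" where
  "hausdorff_weight s U =
     (if U = {} then 0 else ennreal (unit_ball_vol (real s) * (diameter U / 2) ^ s))"

text \<open>In HOL-Analysis \<^const>\<open>diameter\<close> is meaningful for bounded sets only, hence the explicit
  boundedness condition.\<close>

definition hausdorff_pre :: "nat \<Rightarrow> real \<Rightarrow> 'a::metric_space set \<Rightarrow> ennreal" where
  "hausdorff_pre s \<delta> A =
     (INF U \<in> {U :: nat \<Rightarrow> 'a set. A \<subseteq> (\<Union>i. U i) \<and> (\<forall>i. bounded (U i) \<and> diameter (U i) \<le> \<delta>)}.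
        \<Sum>i. hausdorff_weight s (U i))"

definition hausdorff_outer :: "nat \<Rightarrow> 'a::metric_space set \<Rightarrow> ennreal" where
  "hausdorff_outer s A = (SUP \<delta> \<in> {0<..}. hausdorff_pre s \<delta> A)"

text \<open>\<^const>\<open>measure_of\<close> silently yields the null measure if the given function is not countably
  additive; \<open>emeasure_hausdorff\<close> below shows that this does not happen here.\<close>

definition hausdorff_measure :: "nat \<Rightarrow> 'a::metric_space measure" where
  "hausdorff_measure s = measure_of UNIV (sets borel) (hausdorff_outer s)"

lemma space_hausdorff [simp]: "space (hausdorff_measure s) = UNIV"
  by (simp add: hausdorff_measure_def)

lemma sets_hausdorff [simp, measurable_cong]: "sets (hausdorff_measure s) = sets borel"
  by (simp add: hausdorff_measure_def sets.sigma_sets_eq[of borel, simplified])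

lemma hausdorff_pre_eq_outer_measure:
  fixes A :: "'a::metric_space set"
  defines "w \<equiv> \<lambda>s \<delta> (U::'a set).
    if bounded U \<and> diameter U \<le> \<delta> then hausdorff_weight s U else top"
  assumes "\<delta> > 0"
  shows "hausdorff_pre s \<delta> A = outer_measure (Pow UNIV) (w s \<delta>) A"
    and "positive (Pow UNIV) (w s \<delta>)" and "increasing (Pow UNIV) (w s \<delta>)"
proof -
  show pos: "positive (Pow UNIV) (w s \<delta>)"
    using assms(2) by (auto simp: positive_def w_def hausdorff_weight_def)
  show inc: "increasing (Pow UNIV) (w s \<delta>)"
    unfolding increasing_def
  proof safe
    fix U V :: "'a set" assume UV: "U \<subseteq> V"
    show "w s \<delta> U \<le> w s \<delta> V"
    proof (cases "bounded V \<and> diameter V \<le> \<delta>")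
      case True
      then have b: "bounded U" and d: "diameter U \<le> diameter V"
        using UV bounded_subset diameter_subset by blast+
      have "0 \<le> diameter U" using b by (rule diameter_ge_0)
      then show ?thesis
        using True b d UV
        by (auto simp: w_def hausdorff_weight_def
            intro!: ennreal_leI mult_left_mono power_mono)
    qed (auto simp: w_def)
  qed
  interpret ring_of_sets UNIV "Pow UNIV :: 'a set set" by (rule ring_of_sets_Pow)
  show "hausdorff_pre s \<delta> A = outer_measure (Pow UNIV) (w s \<delta>) A"
  proof (rule antisym)
    show "outer_measure (Pow UNIV) (w s \<delta>) A \<le> hausdorff_pre s \<delta> A"
      unfolding hausdorff_pre_def
    proof (rule INF_greatest)
      fix U :: "nat \<Rightarrow> 'a set"
      assume U: "U \<in> {U. A \<subseteq> (\<Union>i. U i) \<and> (\<forall>i. bounded (U i) \<and> diameter (U i) \<le> \<delta>)}"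
      have "outer_measure (Pow UNIV) (w s \<delta>) A \<le> (\<Sum>i. w s \<delta> (U i))"
        by (rule outer_measure_le[OF pos inc]) (use U in auto)
      also have "\<dots> = (\<Sum>i. hausdorff_weight s (U i))"
        using U by (simp add: w_def)
      finally show "outer_measure (Pow UNIV) (w s \<delta>) A \<le> \<dots>" .
    qed
    show "hausdorff_pre s \<delta> A \<le> outer_measure (Pow UNIV) (w s \<delta>) A"
      unfolding outer_measure_def
    proof (rule INF_greatest)
      fix U :: "nat \<Rightarrow> 'a set"
      assume U: "U \<in> {U. range U \<subseteq> Pow UNIV \<and> disjoint_family U \<and> A \<subseteq> (\<Union>i. U i)}"
      show "hausdorff_pre s \<delta> A \<le> (\<Sum>i. w s \<delta> (U i))"
      proof (cases "\<forall>i. bounded (U i) \<and> diameter (U i) \<le> \<delta>")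
        case True
        then have "(\<Sum>i. w s \<delta> (U i)) = (\<Sum>i. hausdorff_weight s (U i))"
          by (simp add: w_def)
        then show ?thesis
          unfolding hausdorff_pre_def by (auto intro!: INF_lower2[of U] simp: U True)
             (use U True in auto)
      next
        case False
        then obtain i where "\<not> (bounded (U i) \<and> diameter (U i) \<le> \<delta>)" by blast
        then have "w s \<delta> (U i) = top" unfolding w_def by (rule if_not_P)
        moreover have "w s \<delta> (U i) \<le> (\<Sum>i. w s \<delta> (U i))"
          using sum_le_suminf[of "\<lambda>i. w s \<delta> (U i)" "{i}"] by simp
        ultimately show ?thesis by (simp add: top_unique)
      qed
    qed
  qed
qed

lemma hausdorff_pre_antimono: "\<delta> \<le> \<epsilon> \<Longrightarrow> hausdorff_pre s \<epsilon> A \<le> hausdorff_pre s \<delta> A"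
  unfolding hausdorff_pre_def by (intro INF_superset_mono) (auto intro: order_trans)

lemma hausdorff_pre_le_outer: "\<delta> > 0 \<Longrightarrow> hausdorff_pre s \<delta> A \<le> hausdorff_outer s A"
  unfolding hausdorff_outer_def by (rule SUP_upper) simp

lemma outer_measure_space_hausdorff:
  "outer_measure_space (Pow UNIV) (hausdorff_outer s :: 'a::metric_space set \<Rightarrow> ennreal)"
proof -
  interpret ring_of_sets UNIV "Pow UNIV :: 'a set set" by (rule ring_of_sets_Pow)
  have *: "outer_measure_space (Pow UNIV) (hausdorff_pre s \<delta> :: 'a set \<Rightarrow> ennreal)"
    if "\<delta> > 0" for \<delta>
    using outer_measure_space_outer_measure[OF hausdorff_pre_eq_outer_measure(2,3)[OF that]]
    by (simp add: hausdorff_pre_eq_outer_measure(1)[OF that, abs_def])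
  show ?thesis
    unfolding outer_measure_space_def
  proof (intro conjI)
    have "hausdorff_pre s \<delta> ({}::'a set) = 0" if "\<delta> > 0" for \<delta>
      using *[OF that] by (simp add: outer_measure_space_def positive_def)
    then show "positive (Pow UNIV) (hausdorff_outer s :: 'a set \<Rightarrow> ennreal)"
      by (simp add: positive_def hausdorff_outer_def)
    show "increasing (Pow UNIV) (hausdorff_outer s :: 'a set \<Rightarrow> ennreal)"
      using * unfolding increasing_def hausdorff_outer_def outer_measure_space_def
      by (intro ballI impI SUP_mono) (metis greaterThan_iff)
    show "countably_subadditive (Pow UNIV) (hausdorff_outer s :: 'a set \<Rightarrow> ennreal)"
      unfolding countably_subadditive_def
    proof safe
      fix A :: "nat \<Rightarrow> 'a set"
      assume A: "range A \<subseteq> Pow UNIV" "disjoint_family A"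
      show "hausdorff_outer s (\<Union>i. A i) \<le> (\<Sum>i. hausdorff_outer s (A i))"
        unfolding hausdorff_outer_def[of s "\<Union>i. A i"]
      proof (rule SUP_least)
        fix \<delta> :: real assume \<delta>: "\<delta> \<in> {0<..}"
        then have "hausdorff_pre s \<delta> (\<Union>i. A i) \<le> (\<Sum>i. hausdorff_pre s \<delta> (A i))"
          using *[of \<delta>] A by (auto simp: outer_measure_space_def countably_subadditive_def)
        also have "\<dots> \<le> (\<Sum>i. hausdorff_outer s (A i))"
          by (intro suminf_le hausdorff_pre_le_outer) (use \<delta> in auto)
        finally show "hausdorff_pre s \<delta> (\<Union>i. A i) \<le> \<dots>" .
      qed
    qed
  qed
qed

lemma hausdorff_outer_separated:
  fixes A B :: "'a::metric_space set"
  assumes e: "e > 0" "\<And>x y. x \<in> A \<Longrightarrow> y \<in> B \<Longrightarrow> e \<le> dist x y"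
  shows "hausdorff_outer s A + hausdorff_outer s B \<le> hausdorff_outer s (A \<union> B)"
proof -
  have small: "hausdorff_pre s \<delta> A + hausdorff_pre s \<delta> B \<le> hausdorff_pre s \<delta> (A \<union> B)"
    if \<delta>: "0 < \<delta>" "\<delta> < e" for \<delta>
    unfolding hausdorff_pre_def[of s \<delta> "A \<union> B"]
  proof (rule INF_greatest)
    fix U :: "nat \<Rightarrow> 'a set"
    assume U: "U \<in> {U. A \<union> B \<subseteq> (\<Union>i. U i) \<and> (\<forall>i. bounded (U i) \<and> diameter (U i) \<le> \<delta>)}"
    have bdd: "bounded (U i)" and diam: "diameter (U i) \<le> \<delta>" for i
      using U by auto
    have sub: "bounded (U i \<inter> C)" "diameter (U i \<inter> C) \<le> diameter (U i)" for i C
      by (rule bounded_Int[OF disjI1[OF bdd]]) (rule diameter_subset[OF Int_lower1 bdd])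
    have sub': "diameter (U i \<inter> C) \<le> \<delta>" for i C
      using sub(2)[of i C] diam[of i] by linarith
    have cover: "hausdorff_pre s \<delta> C \<le> (\<Sum>i. hausdorff_weight s (U i \<inter> C))"
      if "C \<subseteq> A \<union> B" for C
      unfolding hausdorff_pre_def
      by (rule INF_lower) (use U that sub(1) sub' in auto)
    have mono: "hausdorff_weight s (U i \<inter> C) \<le> hausdorff_weight s (U i)" for i C
      using sub[of i C] diameter_ge_0[OF sub(1)[of i C]]
      by (auto simp: hausdorff_weight_def intro!: ennreal_leI mult_left_mono power_mono)
    have split: "hausdorff_weight s (U i \<inter> A) + hausdorff_weight s (U i \<inter> B)
        \<le> hausdorff_weight s (U i)" for i
    proof (cases "U i \<inter> A = {} \<or> U i \<inter> B = {}")
      case True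
      then show ?thesis using mono[of i A] mono[of i B]
        by (auto simp: hausdorff_weight_def[of s "{}"])
    next
      case False
      then obtain x y where "x \<in> U i" "x \<in> A" "y \<in> U i" "y \<in> B" by auto
      then have "e \<le> diameter (U i)"
        using e(2)[of x y] diameter_bounded_bound[OF bdd, of x i y] by linarith
      with diam[of i] \<delta> have False by linarith
      then show ?thesis ..
    qed
    have "hausdorff_pre s \<delta> A + hausdorff_pre s \<delta> B
        \<le> (\<Sum>i. hausdorff_weight s (U i \<inter> A)) + (\<Sum>i. hausdorff_weight s (U i \<inter> B))"
      by (intro add_mono cover) auto
    also have "\<dots> = (\<Sum>i. hausdorff_weight s (U i \<inter> A) + hausdorff_weight s (U i \<inter> B))"
      by (rule suminf_add) auto
    also have "\<dots> \<le> (\<Sum>i. hausdorff_weight s (U i))"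
      by (intro suminf_le split) auto
    finally show "hausdorff_pre s \<delta> A + hausdorff_pre s \<delta> B \<le> \<dots>" .
  qed
  have "hausdorff_pre s \<delta> A + hausdorff_pre s \<epsilon> B \<le> hausdorff_outer s (A \<union> B)"
    if "0 < \<delta>" "0 < \<epsilon>" for \<delta> \<epsilon>
  proof -
    let ?m = "min (min \<delta> \<epsilon>) (e / 2)"
    have m: "0 < ?m" "?m < e" using that e by auto
    have "hausdorff_pre s \<delta> A + hausdorff_pre s \<epsilon> B \<le> hausdorff_pre s ?m A + hausdorff_pre s ?m B"
      by (intro add_mono hausdorff_pre_antimono) auto
    also have "\<dots> \<le> hausdorff_pre s ?m (A \<union> B)" by (rule small) (use m in auto)
    also have "\<dots> \<le> hausdorff_outer s (A \<union> B)" by (rule hausdorff_pre_le_outer[OF m(1)])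
    finally show ?thesis .
  qed
  then have "(SUP \<delta>\<in>{0<..}. hausdorff_pre s \<delta> A + hausdorff_pre s \<epsilon> B) \<le> hausdorff_outer s (A \<union> B)"
    if "0 < \<epsilon>" for \<epsilon>
    using that by (intro SUP_least) simp
  then have "hausdorff_outer s A + hausdorff_pre s \<epsilon> B \<le> hausdorff_outer s (A \<union> B)" if "0 < \<epsilon>" for \<epsilon>
    using that by (simp add: ennreal_SUP_add_left hausdorff_outer_def[of s A])
  then have "(SUP \<epsilon>\<in>{0<..}. hausdorff_outer s A + hausdorff_pre s \<epsilon> B) \<le> hausdorff_outer s (A \<union> B)"
    by (intro SUP_least) simp
  then show ?thesis
    by (simp add: ennreal_SUP_add_right[symmetric] hausdorff_outer_def[of s B])
qed

lemma closed_caratheodory_measurable: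
  fixes f :: "'a::metric_space set \<Rightarrow> ennreal"
  assumes oms: "outer_measure_space (Pow UNIV) f"
    and sep: "\<And>A B e. 0 < e \<Longrightarrow> (\<And>x y. x \<in> A \<Longrightarrow> y \<in> B \<Longrightarrow> e \<le> dist x y) \<Longrightarrow> f A + f B \<le> f (A \<union> B)"
    and F: "closed F"
  shows "f (A \<inter> F) + f (A - F) \<le> f A"
proof (cases "F = {} \<or> f A = top")
  case True
  with oms show ?thesis by (auto simp: outer_measure_space_def positive_def)
next
  case False
  interpret ring_of_sets UNIV "Pow UNIV :: 'a set set" by (rule ring_of_sets_Pow)
  have f0: "f {} = 0" and mono: "\<And>X Y. X \<subseteq> Y \<Longrightarrow> f X \<le> f Y"
    using oms by (auto simp: outer_measure_space_def positive_def increasing_def)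
  have subadd: "f (\<Union>i. X i) \<le> (\<Sum>i. f (X i))" for X :: "nat \<Rightarrow> 'a set"
  proof -
    have "f (\<Union>i. disjointed X i) \<le> (\<Sum>i. f (disjointed X i))"
      using oms disjoint_family_disjointed[of X]
      by (auto simp: outer_measure_space_def countably_subadditive_def)
    also have "\<dots> \<le> (\<Sum>i. f (X i))"
      by (intro suminf_le mono disjointed_subset) auto
    finally show ?thesis by (simp add: UN_disjointed_eq)
  qed
  define D where "D n = {x \<in> A. 1 / real (Suc n) \<le> infdist x F}" for n
  define R where "R k = D (Suc k) - D k" for k
  have D_mono: "D m \<subseteq> D n" if "m \<le> n" for m n
  proof -
    have "1 / real (Suc n) \<le> 1 / real (Suc m)" using that by (intro frac_le) auto
    then show ?thesis unfolding D_def by auto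
  qed
  have infdist_tri: "infdist x F \<le> infdist y F + dist x y" for x y
    by (rule infdist_triangle)
  have R_sep: "\<exists>e>0. \<forall>x\<in>D n. \<forall>y\<in>R (Suc n + k). e \<le> dist x y" for n k
  proof (intro exI conjI ballI)
    show "0 < 1 / real (Suc n) - 1 / real (Suc (Suc n))"
      using frac_less2[of 1 1 "real (Suc n)" "real (Suc (Suc n))"] by simp
    fix x y assume x: "x \<in> D n" and y: "y \<in> R (Suc n + k)"
    have "y \<in> A" "y \<notin> D (Suc n)"
      using y D_mono[of "Suc n" "Suc n + k"] by (auto simp: R_def D_def)
    then have "infdist y F < 1 / real (Suc (Suc n))" by (auto simp: D_def)
    with x show "1 / real (Suc n) - 1 / real (Suc (Suc n)) \<le> dist x y"
      using infdist_tri[of x y] by (auto simp: D_def)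
  qed
  have part: "(\<Sum>k<n. f (R (2 * k + Suc j))) \<le> f (D (2 * n + j))" for n j
  proof (induction n)
    case (Suc n)
    obtain e where e: "e > 0" "\<And>x y. x \<in> D (2 * n + j) \<Longrightarrow> y \<in> R (2 * n + Suc j) \<Longrightarrow> e \<le> dist x y"
      using R_sep[of "2 * n + j" 0] by auto
    have "(\<Sum>k<Suc n. f (R (2 * k + Suc j))) \<le> f (D (2 * n + j)) + f (R (2 * n + Suc j))"
      using Suc.IH by (simp add: add_right_mono)
    also have "\<dots> \<le> f (D (2 * n + j) \<union> R (2 * n + Suc j))" by (rule sep[OF e])
    also have "\<dots> \<le> f (D (2 * Suc n + j))"
      using D_mono[of "2 * n + j" "2 * Suc n + j"] by (intro mono) (auto simp: R_def)
    finally show ?case .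
  qed simp
  define S where "S = (\<Sum>k. f (R (Suc k)))"
  have "(\<Sum>k<2 * n. f (R (Suc k))) = (\<Sum>k<n. f (R (2 * k + 1))) + (\<Sum>k<n. f (R (2 * k + 2)))" for n
    by (induction n) (simp_all add: algebra_simps)
  moreover have D_A: "f (D n) \<le> f A" for n by (rule mono) (auto simp: D_def)
  ultimately have "(\<Sum>k<2 * n. f (R (Suc k))) \<le> f A + f A" for n
    using add_mono[OF order_trans[OF part[of 0 n] D_A] order_trans[OF part[of 1 n] D_A]]
    by simp
  then have "(\<Sum>k<n. f (R (Suc k))) \<le> f A + f A" for n
    using sum_mono2[of "{..<2 * n}" "{..<n}" "\<lambda>k. f (R (Suc k))"]
    by (force intro: order_trans)
  then have "S \<le> f A + f A"
    unfolding S_def suminf_eq_SUP by (intro SUP_least)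
  with False have S_fin: "S \<noteq> top"
    by (metis ennreal_add_eq_top top_unique)
  have D_UN: "A - F \<subseteq> (\<Union>n. D n)"
  proof
    fix x assume x: "x \<in> A - F"
    with F False have "infdist x F > 0" by (simp add: infdist_pos_not_in_closed)
    then obtain n where "inverse (real (Suc n)) < infdist x F" using reals_Archimedean by blast
    with x show "x \<in> (\<Union>n. D n)" by (auto simp: D_def inverse_eq_divide intro!: exI[of _ n])
  qed
  have "f (A \<inter> F) + f (A - F) + (\<Sum>k<n. f (R (Suc k))) \<le> f A + S" for n
  proof -
    let ?X = "case_nat (D (Suc n)) (\<lambda>k. R (Suc (k + n)))"
    have in_X: "x \<in> (\<Union>i. ?X i)" if "x \<in> D m" for m x
      using that
    proof (induction m)
      case 0
      then show ?case using D_mono[of 0 "Suc n"] by (auto intro!: exI[of _ 0])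
    next
      case (Suc m)
      consider "x \<in> D m" | "m \<le> n" | "x \<notin> D m" "n < m" by linarith
      then show ?case
      proof cases
        case 1
        then show ?thesis by (rule Suc.IH)
      next
        case 2
        then have "x \<in> ?X 0" using Suc.prems D_mono[of "Suc m" "Suc n"] by auto
        then show ?thesis by blast
      next
        case 3
        then have "x \<in> ?X (Suc (m - Suc n))" using Suc.prems by (auto simp: R_def)
        then show ?thesis by blast
      qed
    qed
    have "f (A - F) \<le> f (\<Union>i. ?X i)"
      using D_UN in_X by (intro mono) blast
    also have "\<dots> \<le> (\<Sum>i. f (?X i))" by (rule subadd)
    also have "\<dots> = (\<Sum>i. f (?X (i + 1))) + (\<Sum>i<1. f (?X i))"
      by (rule suminf_offset) auto
    finally have 1: "f (A - F) \<le> f (D (Suc n)) + (\<Sum>k. f (R (Suc (k + n))))"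
      by (simp add: add.commute)
    have 2: "S = (\<Sum>k. f (R (Suc (k + n)))) + (\<Sum>k<n. f (R (Suc k)))"
      unfolding S_def by (rule suminf_offset) auto
    have "f (A \<inter> F) + f (D (Suc n)) \<le> f (A \<inter> F \<union> D (Suc n))"
    proof (rule sep)
      show "0 < 1 / real (Suc (Suc n))" by simp
      fix x y assume x: "x \<in> A \<inter> F" and y: "y \<in> D (Suc n)"
      then have "infdist y F \<le> dist y x" by (intro infdist_le) auto
      with y show "1 / real (Suc (Suc n)) \<le> dist x y" by (auto simp: D_def dist_commute)
    qed
    also have "\<dots> \<le> f A" by (rule mono) (auto simp: D_def)
    finally have 3: "f (A \<inter> F) + f (D (Suc n)) \<le> f A" .
    have "f (A \<inter> F) + f (A - F) + (\<Sum>k<n. f (R (Suc k)))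
        \<le> f (A \<inter> F) + (f (D (Suc n)) + (\<Sum>k. f (R (Suc (k + n))))) + (\<Sum>k<n. f (R (Suc k)))"
      by (intro add_mono 1 order_refl)
    also have "\<dots> = (f (A \<inter> F) + f (D (Suc n))) + S" by (simp add: 2 ac_simps)
    also have "\<dots> \<le> f A + S" by (intro add_mono 3 order_refl)
    finally show ?thesis .
  qed
  then have "f (A \<inter> F) + f (A - F) + S \<le> f A + S"
    using ennreal_suminf_bound_add[of "\<lambda>k. f (R (Suc k))" "f (A \<inter> F) + f (A - F)" "f A + S"]
    by (simp add: S_def add.commute)
  then show ?thesis
    using S_fin ennreal_add_left_cancel_le[of S "f (A \<inter> F) + f (A - F)" "f A"]
    by (simp add: add.commute)
qed

theorem emeasure_hausdorff:
  fixes A :: "'a::metric_space set"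
  assumes "A \<in> sets borel"
  shows "emeasure (hausdorff_measure s) A = hausdorff_outer s A"
proof -
  let ?f = "hausdorff_outer s :: 'a set \<Rightarrow> ennreal"
  let ?L = "lambda_system UNIV (Pow UNIV) ?f"
  interpret sigma_algebra UNIV "Pow UNIV :: 'a set set" by (rule sigma_algebra_Pow)
  note oms = outer_measure_space_hausdorff[of s, where ?'a = 'a]
  have L: "measure_space UNIV ?L ?f" by (rule caratheodory_lemma[OF oms])
  then interpret L: sigma_algebra UNIV ?L by (simp add: measure_space_def)
  have "Collect closed \<subseteq> ?L"
  proof
    fix F :: "'a set" assume "F \<in> Collect closed"
    have "?f (X \<inter> F) + ?f (X - F) = ?f X" for X
    proof (rule antisym)
      show "?f (X \<inter> F) + ?f (X - F) \<le> ?f X"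
        using \<open>F \<in> Collect closed\<close>
        by (intro closed_caratheodory_measurable[OF oms] hausdorff_outer_separated) auto
      have "subadditive (Pow UNIV) ?f"
        using oms countably_subadditive_subadditive[of ?f] by (auto simp: outer_measure_space_def)
      then have "?f (X \<inter> F \<union> (X - F)) \<le> ?f (X \<inter> F) + ?f (X - F)"
        unfolding subadditive_def by (elim ballE[of _ _ "X \<inter> F"] ballE[of _ _ "X - F"]) auto
      then show "?f X \<le> ?f (X \<inter> F) + ?f (X - F)"
        by (simp add: Int_Diff_Un)
    qed
    then show "F \<in> ?L" unfolding lambda_system_eq by simp
  qed
  then have "sets borel \<subseteq> ?L"
    using L.sigma_sets_subset[of "Collect closed"] by (subst borel_eq_closed) simp
  then have "measure_space UNIV (sets borel) ?f"
    using measure_down[OF L] sets.sigma_algebra_axioms[of "borel :: 'a measure"] by simp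
  then show ?thesis
    using assms unfolding hausdorff_measure_def measure_space_def
    by (blast intro: emeasure_measure_of_sigma)
qed

definition support_fun :: "'a::euclidean_space set \<Rightarrow> 'a \<Rightarrow> real" where
  "support_fun M u = (SUP x\<in>M. u \<bullet> x)"

text \<open>\<^term>\<open>unit_ball_vol (real n)\<close> is the volume of the \<open>n\<close>-dimensional unit ball.\<close>

definition mean_width :: "'a::euclidean_space set \<Rightarrow> real" where
  "mean_width M = 2 / (real DIM('a) * unit_ball_vol (real DIM('a))) *
     (LINT u:sphere 0 1|hausdorff_measure (DIM('a) - 1). support_fun M u)"

definition convex_body :: "'a::euclidean_space set \<Rightarrow> bool" where
  "convex_body K \<longleftrightarrow> compact K \<and> convex K \<and> interior K \<noteq> {}"

definition rolls_freely_in :: "'a::euclidean_space set \<Rightarrow> 'a set \<Rightarrow> bool" where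
  "rolls_freely_in B K \<longleftrightarrow> (\<forall>p\<in>frontier K. \<exists>v. p \<in> (+) v ` B \<and> (+) v ` B \<subseteq> K)"

text \<open>Only the values of a density on \<open>K\<close> matter; Lebesgue (not necessarily Borel) measurable
  densities are allowed.\<close>

definition prob_density_on :: "'a::euclidean_space set \<Rightarrow> ('a \<Rightarrow> real) \<Rightarrow> bool" where
  "prob_density_on K \<rho> \<longleftrightarrow>
     \<rho> \<in> borel_measurable (lebesgue_on K) \<and> (\<forall>x\<in>K. 0 \<le> \<rho> x) \<and>
     (\<integral>\<^sup>+x. ennreal (\<rho> x) \<partial>lebesgue_on K) = 1"

definition iid_points :: "'a::euclidean_space set \<Rightarrow> ('a \<Rightarrow> real) \<Rightarrow> nat \<Rightarrow> (nat \<Rightarrow> 'a) measure" where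
  "iid_points K \<rho> n = (\<Pi>\<^sub>M i\<in>{..<n}. density (lebesgue_on K) (\<lambda>x. ennreal (\<rho> x)))"

definition random_polytope :: "nat \<Rightarrow> (nat \<Rightarrow> 'a::euclidean_space) \<Rightarrow> 'a set" where
  "random_polytope n X = convex hull (X ` {..<n})"

lemma prob_space_iid_points:
  assumes "prob_density_on K \<rho>"
  shows "prob_space (iid_points K \<rho> n)"
proof -
  let ?M = "density (lebesgue_on K) (\<lambda>x. ennreal (\<rho> x))"
  have "prob_space ?M"
  proof (rule prob_spaceI)
    have [measurable]: "\<rho> \<in> borel_measurable (lebesgue_on K)"
      using assms by (simp add: prob_density_on_def)
    have "emeasure ?M (space (lebesgue_on K))
        = (\<integral>\<^sup>+x. ennreal (\<rho> x) \<partial>lebesgue_on K)"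
      by (subst emeasure_density) (auto intro!: nn_integral_cong)
    with assms show "emeasure ?M (space ?M) = 1"
      by (simp only: prob_density_on_def space_density)
  qed
  then show ?thesis
    unfolding iid_points_def by (intro prob_space_PiM)
qed

end

theory Submission
  imports Defs
begin

text \<open>By the Efron--Stein inequality the variance is at most the sum over \<open>i\<close> of the mean squares of the
  changes caused by deleting the \<open>i\<close>-th point. Such a change is, up to a constant, the integral over the
  directions \<open>u\<close> of the jump \<open>D u\<close> of the support function. It is nonzero only where the deleted point
  \<open>x\<close> has a smaller gap \<open>h K u - u \<bullet> x\<close> than all other points, and is then at most the smallest gap
  \<open>m u\<close> of the other points.
  Since \<open>K\<close> is a union of balls of radius \<open>r\<close>, two directions \<open>u\<close>, \<open>v\<close> in which the same point has gap at
  most \<open>t\<close> differ by \<open>O(sqrt t)\<close>. Hence the square of the integral of \<open>D\<close> is bounded by the integral of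
  \<open>m u powr ((d + 3) / 2)\<close> over the directions where \<open>D\<close> is positive. In each direction at most one
  \<open>i\<close> contributes, and splitting the sample into two halves bounds its \<open>m u\<close> by the smallest gap of one
  of the halves, now independently of \<open>i\<close>. Finally, a cap of height \<open>s\<close> has probability at least
  \<open>c * s powr ((d + 1) / 2)\<close>, again by the rolling ball, and this controls the moments of the smallest
  gap.\<close>

section \<open>The Efron--Stein inequality\<close>

lemma (in prob_space) integrable_bounded:
  fixes f :: "'a \<Rightarrow> real"
  assumes "f \<in> borel_measurable M" "\<And>x. x \<in> space M \<Longrightarrow> \<bar>f x\<bar> \<le> B"
  shows "integrable M f"
  using assms by (intro integrable_const_bound[where B=B]) auto

text \<open>Bias-variance identity. Since the last term is nonnegative, the variance is the least
  mean square deviation from a constant; with \<open>c\<close> equal to the mean it yields Jensen's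
  inequality for squares.\<close>

lemma (in prob_space) integral_square_deviation:
  fixes f :: "'a \<Rightarrow> real"
  assumes [measurable]: "f \<in> borel_measurable M" and B: "\<And>x. x \<in> space M \<Longrightarrow> \<bar>f x\<bar> \<le> B"
  shows "(\<integral>x. (f x - c)\<^sup>2 \<partial>M) = (\<integral>x. (f x)\<^sup>2 \<partial>M) - (\<integral>x. f x \<partial>M)\<^sup>2 + ((\<integral>x. f x \<partial>M) - c)\<^sup>2"
proof -
  have [simp]: "integrable M f" by (rule integrable_bounded[OF _ B]) auto
  have "\<bar>(f x)\<^sup>2\<bar> \<le> B\<^sup>2" if "x \<in> space M" for x
    using power_mono[OF B[OF that], of 2] by simp
  then have [simp]: "integrable M (\<lambda>x. (f x)\<^sup>2)"
    by (intro integrable_bounded[of _ "B\<^sup>2"]) auto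
  have "(\<integral>x. (f x - c)\<^sup>2 \<partial>M) = (\<integral>x. (f x)\<^sup>2 - 2 * c * f x + c\<^sup>2 \<partial>M)"
    by (intro Bochner_Integration.integral_cong) (auto simp: power2_eq_square algebra_simps)
  also have "\<dots> = (\<integral>x. (f x)\<^sup>2 \<partial>M) - 2 * c * (\<integral>x. f x \<partial>M) + c\<^sup>2"
    by (simp add: prob_space)
  finally show ?thesis by (simp add: power2_eq_square algebra_simps)
qed

text \<open>Jackknife form: in place of an independent copy of the sample, \<open>g i\<close> is an
  arbitrary bounded statistic that ignores coordinate \<open>i\<close>. The induction integrates out
  one coordinate and splits the variance into the mean conditional variance and the variance of the
  conditional mean.\<close>

theorem efron_stein:
  fixes M :: "'i \<Rightarrow> 'b measure" and f :: "('i \<Rightarrow> 'b) \<Rightarrow> real"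
  assumes M: "\<And>i. prob_space (M i)" and "finite I"
    and "f \<in> borel_measurable (PiM I M)" "\<And>x. x \<in> space (PiM I M) \<Longrightarrow> \<bar>f x\<bar> \<le> B"
    and "\<And>i. i \<in> I \<Longrightarrow> g i \<in> borel_measurable (PiM I M)"
    and "\<And>i x. i \<in> I \<Longrightarrow> x \<in> space (PiM I M) \<Longrightarrow> \<bar>g i x\<bar> \<le> B"
    and "\<And>i x y. i \<in> I \<Longrightarrow> x \<in> space (PiM I M) \<Longrightarrow> y \<in> space (M i) \<Longrightarrow> g i (x(i := y)) = g i x"
  shows "prob_space.variance (PiM I M) f \<le> (\<Sum>i\<in>I. \<integral>x. (f x - g i x)\<^sup>2 \<partial>PiM I M)"
  using assms(2-)
proof (induction I arbitrary: f g rule: finite_induct)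
  case empty
  interpret P: prob_space "PiM {} M" by (intro prob_space_PiM M)
  \<comment> \<open>A product over no indices is a one-point space, so the variance
    vanishes.\<close>
  have f: "f x = f (\<lambda>_. undefined)" if "x \<in> space (PiM {} M)" for x
  proof -
    have "x = (\<lambda>_. undefined)" using that by (simp add: space_PiM)
    then show ?thesis by (rule arg_cong)
  qed
  have "P.expectation f = P.expectation (\<lambda>_. f (\<lambda>_. undefined))"
    by (rule Bochner_Integration.integral_cong[OF refl f])
  then have "P.expectation f = f (\<lambda>_. undefined)" by (simp add: P.prob_space)
  then have "P.variance f = P.expectation (\<lambda>x. 0)"
    by (intro Bochner_Integration.integral_cong refl) (simp add: space_PiM)
  then show ?case by simp
next
  case (insert i I)
  interpret Mi: prob_space "M i" by (rule M)
  interpret product_sigma_finite M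
    by (intro product_sigma_finite.intro prob_space_imp_sigma_finite M)
  interpret P: prob_space "PiM I M" by (intro prob_space_PiM M)
  interpret Q: prob_space "PiM (insert i I) M" by (intro prob_space_PiM M)
  note insert.prems(1)[measurable]
  have B0: "0 \<le> B" using Q.not_empty insert.prems(2) abs_ge_zero order_trans by blast
  have upd: "x(i := y) \<in> space (PiM (insert i I) M)" if "x \<in> space (PiM I M)" "y \<in> space (M i)" for x y
    using that by (auto simp: space_PiM PiE_def extensional_def)
  have fm [measurable]: "(\<lambda>(x, y). h (x(i := y))) \<in> borel_measurable (PiM I M \<Otimes>\<^sub>M M i)"
    if "h \<in> borel_measurable (PiM (insert i I) M)" for h :: "_ \<Rightarrow> real"
    using measurable_compose[OF measurable_add_dim that] by (simp add: case_prod_beta comp_def)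
  have fm1 [measurable]: "(\<lambda>y. h (x(i := y))) \<in> borel_measurable (M i)"
    if "h \<in> borel_measurable (PiM (insert i I) M)" "x \<in> space (PiM I M)" for h :: "_ \<Rightarrow> real" and x
    using measurable_Pair2[OF fm[OF that(1)] that(2)] by simp
  have Im: "(\<lambda>x. \<integral>y. h (x(i := y)) \<partial>M i) \<in> borel_measurable (PiM I M)"
    if "h \<in> borel_measurable (PiM (insert i I) M)" for h :: "_ \<Rightarrow> real"
    using Mi.borel_measurable_lebesgue_integral[OF fm[OF that]] by simp
  have IB: "\<bar>\<integral>y. h (x(i := y)) \<partial>M i\<bar> \<le> b"
    if "h \<in> borel_measurable (PiM (insert i I) M)" "x \<in> space (PiM I M)"
      "\<And>x. x \<in> space (PiM (insert i I) M) \<Longrightarrow> \<bar>h x\<bar> \<le> b" for h :: "_ \<Rightarrow> real" and x b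
  proof -
    have i: "integrable (M i) (\<lambda>y. h (x(i := y)))"
      by (rule Mi.integrable_bounded[where B=b]) (use that upd in auto)
    have "\<bar>\<integral>y. h (x(i := y)) \<partial>M i\<bar> \<le> (\<integral>y. \<bar>h (x(i := y))\<bar> \<partial>M i)" by simp
    also have "\<dots> \<le> (\<integral>y. b \<partial>M i)"
      by (intro integral_mono) (use i that upd in auto)
    finally show ?thesis by (simp add: Mi.prob_space)
  qed
  have ins: "(\<integral>x. h x \<partial>PiM (insert i I) M) = (\<integral>x. (\<integral>y. h (x(i := y)) \<partial>M i) \<partial>PiM I M)"
    if "h \<in> borel_measurable (PiM (insert i I) M)" "\<And>x. x \<in> space (PiM (insert i I) M) \<Longrightarrow> \<bar>h x\<bar> \<le> b"
    for h :: "_ \<Rightarrow> real" and b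
    by (intro product_integral_insert insert.hyps Q.integrable_bounded[where B=b] that)
  have sq: "\<bar>(a - b)\<^sup>2\<bar> \<le> (2 * B)\<^sup>2" if "\<bar>a\<bar> \<le> B" "\<bar>b\<bar> \<le> B" for a b :: real
    using power_mono[of "\<bar>a - b\<bar>" "2 * B" 2] that by simp
  have sq1: "\<bar>a\<^sup>2\<bar> \<le> B\<^sup>2" if "\<bar>a\<bar> \<le> B" for a :: real
    using power_mono[of "\<bar>a\<bar>" B 2] that by simp
  \<comment> \<open>\<open>F\<close> and \<open>G j\<close> are the conditional means given all
    coordinates but \<open>i\<close>; the induction hypothesis is applied to them.\<close>
  define F where "F x = (\<integral>y. f (x(i := y)) \<partial>M i)" for x
  define G where "G j x = (\<integral>y. g j (x(i := y)) \<partial>M i)" for j x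
  have Fm [measurable]: "F \<in> borel_measurable (PiM I M)"
    unfolding F_def by (rule Im) measurable
  have FB: "\<bar>F x\<bar> \<le> B" if "x \<in> space (PiM I M)" for x
    unfolding F_def by (rule IB) (use that insert.prems in auto)
  define H where "H h = (\<lambda>x. \<integral>y. (f (x(i := y)) - h (x(i := y)))\<^sup>2 \<partial>M i)" for h
  have sqm: "(\<lambda>x. (f x - h x)\<^sup>2) \<in> borel_measurable (PiM (insert i I) M)"
    if "h \<in> borel_measurable (PiM (insert i I) M)" for h
    using that by measurable
  have Hint: "(\<integral>x. (f x - g j x)\<^sup>2 \<partial>PiM (insert i I) M) = (\<integral>x. H (g j) x \<partial>PiM I M)"
    and Hi: "integrable (PiM I M) (H (g j))" if "j \<in> insert i I" for j
  proof -
    have gm: "g j \<in> borel_measurable (PiM (insert i I) M)" using that insert.prems by auto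
    have b: "\<bar>(f x - g j x)\<^sup>2\<bar> \<le> (2 * B)\<^sup>2" if "x \<in> space (PiM (insert i I) M)" for x
      using insert.prems that \<open>j \<in> _\<close> by (intro sq) auto
    show "(\<integral>x. (f x - g j x)\<^sup>2 \<partial>PiM (insert i I) M) = (\<integral>x. H (g j) x \<partial>PiM I M)"
      unfolding H_def by (rule ins[OF sqm[OF gm] b])
    show "integrable (PiM I M) (H (g j))"
      unfolding H_def
      by (rule P.integrable_bounded[where B="(2 * B)\<^sup>2"]) (use Im[OF sqm[OF gm]] IB[OF sqm[OF gm] _ b] in auto)
  qed
  have f2m: "(\<lambda>x. (f x)\<^sup>2) \<in> borel_measurable (PiM (insert i I) M)" by measurable
  have f2b: "\<bar>(f x)\<^sup>2\<bar> \<le> B\<^sup>2" if "x \<in> space (PiM (insert i I) M)" for x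
    using insert.prems that by (intro sq1) auto
  let ?S = "\<lambda>x. \<integral>y. (f (x(i := y)))\<^sup>2 \<partial>M i"
  have Si: "integrable (PiM I M) ?S"
    by (rule P.integrable_bounded[where B="B\<^sup>2"]) (use Im[OF f2m] IB[OF f2m _ f2b] in auto)
  have F2i: "integrable (PiM I M) (\<lambda>x. (F x)\<^sup>2)"
    by (rule P.integrable_bounded[where B="B\<^sup>2"]) (use sq1[OF FB] in auto)
  have mean: "Q.expectation f = P.expectation F"
    unfolding F_def by (rule ins[OF insert.prems(1,2)])
  \<comment> \<open>Law of total variance: \<open>?S x - (F x)\<^sup>2\<close> is the conditional
    variance given the coordinates in \<open>I\<close>.\<close>
  have "Q.variance f = Q.expectation (\<lambda>x. (f x)\<^sup>2) - (Q.expectation f)\<^sup>2"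
    by (subst Q.integral_square_deviation[OF insert.prems(1,2)]) auto
  also have "\<dots> = P.expectation (\<lambda>x. ?S x - (F x)\<^sup>2)
      + (P.expectation (\<lambda>x. (F x)\<^sup>2) - (P.expectation F)\<^sup>2)"
    using Si F2i by (simp add: mean ins[OF f2m f2b])
  also have "P.expectation (\<lambda>x. (F x)\<^sup>2) - (P.expectation F)\<^sup>2 = P.variance F"
    by (subst P.integral_square_deviation[OF Fm FB]) auto
  \<comment> \<open>For fixed \<open>x\<close> the value of \<open>g i\<close> does not change with
    the new coordinate, and the mean square deviation from a constant is at least the
    variance.\<close>
  also have "P.expectation (\<lambda>x. ?S x - (F x)\<^sup>2) \<le> P.expectation (H (g i))"
  proof (intro integral_mono Hi)
    fix x assume x: "x \<in> space (PiM I M)"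
    obtain y0 where y0: "y0 \<in> space (M i)" using Mi.not_empty by auto
    have gx: "g i (x(i := y)) = g i (x(i := y0))" if "y \<in> space (M i)" for y
      using insert.prems(5)[OF insertI1 upd[OF x y0] that] by (simp only: fun_upd_upd)
    have "H (g i) x = (\<integral>y. (f (x(i := y)) - g i (x(i := y0)))\<^sup>2 \<partial>M i)"
      unfolding H_def by (intro Bochner_Integration.integral_cong refl) (simp add: gx)
    also have "\<dots> = ?S x - (F x)\<^sup>2 + (F x - g i (x(i := y0)))\<^sup>2"
      unfolding F_def
      by (rule Mi.integral_square_deviation[where B=B]) (use x insert.prems upd in auto)
    finally show "?S x - (F x)\<^sup>2 \<le> H (g i) x" by simp
  qed (use Si F2i in auto)
  also have "P.variance F \<le> (\<Sum>j\<in>I. P.expectation (\<lambda>x. (F x - G j x)\<^sup>2))"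
  proof (rule insert.IH)
    show "F \<in> borel_measurable (PiM I M)" by measurable
    fix j assume j: "j \<in> I"
    have gm: "g j \<in> borel_measurable (PiM (insert i I) M)" using j insert.prems by auto
    show "G j \<in> borel_measurable (PiM I M)"
      unfolding G_def by (rule Im[OF gm])
    show "\<bar>G j x\<bar> \<le> B" if "x \<in> space (PiM I M)" for x
      unfolding G_def by (rule IB[OF gm that]) (use j insert.prems in auto)
    show "G j (x(j := y)) = G j x" if "x \<in> space (PiM I M)" "y \<in> space (M j)" for x y
      unfolding G_def
    proof (intro Bochner_Integration.integral_cong refl)
      fix z assume z: "z \<in> space (M i)"
      have "j \<noteq> i" using j insert.hyps by auto
      then show "g j (x(j := y, i := z)) = g j (x(i := z))"
        using insert.prems(5)[OF insertI2[OF j] upd[OF that(1) z] that(2)] by (metis fun_upd_twist)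
    qed
  qed (use FB in auto)
  \<comment> \<open>Jensen's inequality in coordinate \<open>i\<close>: \<open>F x - G j x\<close>
    is the mean of \<open>f - g j\<close> over that coordinate.\<close>
  also have "(\<Sum>j\<in>I. P.expectation (\<lambda>x. (F x - G j x)\<^sup>2)) \<le> (\<Sum>j\<in>I. P.expectation (H (g j)))"
  proof (intro sum_mono integral_mono Hi)
    fix j assume j: "j \<in> I"
    have gm [measurable]: "g j \<in> borel_measurable (PiM (insert i I) M)" using j insert.prems by auto
    have gb: "\<bar>g j x\<bar> \<le> B" if "x \<in> space (PiM (insert i I) M)" for x
      using insert.prems(4) j that by auto
    show "integrable (PiM I M) (\<lambda>x. (F x - G j x)\<^sup>2)"
    proof (rule P.integrable_bounded[where B="(2 * B)\<^sup>2"])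
      show "(\<lambda>x. (F x - G j x)\<^sup>2) \<in> borel_measurable (PiM I M)"
        using Im[OF gm] Fm unfolding G_def by measurable
      show "\<bar>(F x - G j x)\<^sup>2\<bar> \<le> (2 * B)\<^sup>2" if "x \<in> space (PiM I M)" for x
        unfolding G_def by (intro sq FB IB[OF gm] gb that)
    qed
    fix x assume x: "x \<in> space (PiM I M)"
    let ?h = "\<lambda>y. f (x(i := y)) - g j (x(i := y))"
    have hm: "?h \<in> borel_measurable (M i)" using fm1[OF _ x] by measurable
    have hb: "\<bar>?h y\<bar> \<le> 2 * B" if "y \<in> space (M i)" for y
      using insert.prems(2)[OF upd[OF x that]] gb[OF upd[OF x that]] by linarith
    have "F x - G j x = (\<integral>y. ?h y \<partial>M i)"
      unfolding F_def G_def
      by (intro Bochner_Integration.integral_diff[symmetric] Mi.integrable_bounded[where B=B] fm1 x)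
         (use insert.prems upd x gm gb in auto)
    moreover have "0 \<le> (\<integral>y. (?h y - (\<integral>y. ?h y \<partial>M i))\<^sup>2 \<partial>M i)" by simp
    ultimately show "(F x - G j x)\<^sup>2 \<le> H (g j) x"
      using Mi.integral_square_deviation[OF hm hb, where c="\<integral>y. ?h y \<partial>M i"]
      by (simp add: H_def)
  qed auto
  finally have "Q.variance f \<le> P.expectation (H (g i)) + (\<Sum>j\<in>I. P.expectation (H (g j)))" by simp
  then show ?case using insert.hyps by (simp add: Hint)
qed

section \<open>Hausdorff measure of spherical caps\<close>

text \<open>The infimum in \<open>hausdorff_pre\<close> runs over sequences, so the family is
  enumerated and padded with empty sets, which have weight zero even for
  \<open>s = 0\<close>.\<close>

lemma hausdorff_pre_le_finite_cover:
  fixes A :: "'a::metric_space set"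
  assumes "finite J" "A \<subseteq> (\<Union>k\<in>J. U k)" "0 \<le> w" "0 \<le> \<delta>"
    and U: "\<And>k. k \<in> J \<Longrightarrow> bounded (U k) \<and> diameter (U k) \<le> \<delta> \<and> hausdorff_weight s (U k) \<le> ennreal w"
  shows "hausdorff_pre s \<delta> A \<le> ennreal (real (card J) * w)"
proof -
  obtain h where h: "bij_betw h {..<card J} J"
    using ex_bij_betw_nat_finite[OF assms(1)] by (auto simp: atLeast0LessThan)
  define V where "V i = (if i < card J then U (h i) else {})" for i
  have V: "bounded (V i) \<and> diameter (V i) \<le> \<delta>" for i
    using U bij_betwE[OF h] assms(4) by (auto simp: V_def)
  have "(\<Union>i. V i) = (\<Union>i<card J. U (h i))" by (auto simp: V_def split: if_splits)
  also have "\<dots> = (\<Union>k\<in>h ` {..<card J}. U k)" by simp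
  also have "h ` {..<card J} = J" using h by (rule bij_betw_imp_surj_on)
  finally have "hausdorff_pre s \<delta> A \<le> (\<Sum>i. hausdorff_weight s (V i))"
    unfolding hausdorff_pre_def by (intro INF_lower) (use V assms(2) in auto)
  also have "\<dots> = (\<Sum>i<card J. hausdorff_weight s (V i))"
    by (intro suminf_finite) (auto simp: V_def hausdorff_weight_def)
  also have "\<dots> \<le> (\<Sum>i<card J. ennreal w)"
    using U bij_betwE[OF h] by (intro sum_mono) (auto simp: V_def)
  also have "\<dots> = ennreal (real (card J) * w)"
    using assms(3) by (simp add: ennreal_mult ennreal_of_nat_eq_real_of_nat)
  finally show ?thesis .
qed

text \<open>Otherwise the sum of the absolute coordinates, which dominates the norm, would be below
  1.\<close>

lemma exists_large_coordinate:
  fixes x :: "'a::euclidean_space"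
  assumes "norm x = 1"
  obtains b where "b \<in> Basis" "1 / real DIM('a) \<le> \<bar>x \<bullet> b\<bar>"
proof -
  have "\<exists>b\<in>Basis. 1 / real DIM('a) \<le> \<bar>x \<bullet> b\<bar>"
  proof (rule ccontr)
    assume "\<not> ?thesis"
    then have "(\<Sum>b\<in>Basis. \<bar>x \<bullet> b\<bar>) < (\<Sum>b\<in>(Basis::'a set). 1 / real DIM('a))"
      by (intro sum_strict_mono) auto
    then show False using norm_le_l1[of x] assms by simp
  qed
  then show ?thesis using that by blast
qed

lemma grid_index:
  fixes y a \<rho> :: real
  assumes "0 < \<rho>" "0 < m" "\<bar>y - a\<bar> \<le> \<rho>"
  obtains k where "k < m" "a - \<rho> + 2 * \<rho> * real k / real m \<le> y" "y \<le> a - \<rho> + 2 * \<rho> * (real k + 1) / real m"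
proof -
  define z where "z = (y - a + \<rho>) * real m / (2 * \<rho>)"
  have z: "0 \<le> z" "z \<le> m"
    using assms by (auto simp: z_def divide_simps abs_if split: if_splits)
  have y: "y = a - \<rho> + 2 * \<rho> * z / real m"
    using assms by (simp add: z_def)
  have mono: "2 * \<rho> * s / real m \<le> 2 * \<rho> * t / real m" if "s \<le> t" for s t
    using that assms by (intro divide_right_mono mult_left_mono) auto
  \<comment> \<open>The floor of \<open>z\<close> serves except at the right end point, which goes
    into the last closed cell.\<close>
  obtain k where k: "k < m" "real k \<le> z" "z \<le> real k + 1"
  proof (cases "z = m")
    case True
    then show ?thesis using assms(2) by (intro that[of "m - 1"]) (auto simp: of_nat_diff)
  next
    case False
    have "real (nat \<lfloor>z\<rfloor>) \<le> z" "z < real (nat \<lfloor>z\<rfloor>) + 1" using z by auto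
    with False z show ?thesis by (intro that[of "nat \<lfloor>z\<rfloor>"]) linarith+
  qed
  show ?thesis
  proof (rule that[OF k(1)])
    show "a - \<rho> + 2 * \<rho> * real k / real m \<le> y" using mono[OF k(2)] y by linarith
    show "y \<le> a - \<rho> + 2 * \<rho> * (real k + 1) / real m" using mono[OF k(3)] y by linarith
  qed
qed

text \<open>On the patch where the \<open>b\<close>-coordinate is bounded away from zero, the projection along \<open>b\<close> has
  a Lipschitz inverse, so a grid of cubes in the hyperplane pulls back to an efficient cover.\<close>

lemma hausdorff_outer_sphere_patch:
  fixes u b :: "'a::euclidean_space"
  defines "d \<equiv> DIM('a)"
  assumes b: "b \<in> Basis" and "0 < \<rho>" and \<sigma>: "\<bar>\<sigma>\<bar> = (1::real)"
  shows "hausdorff_outer (d - 1) {x \<in> sphere 0 1 \<inter> cball u \<rho>. 1 / real d \<le> \<sigma> * (x \<bullet> b)}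
    \<le> ennreal (unit_ball_vol (real (d - 1)) * (2 * (real d)\<^sup>2 * \<rho>) ^ (d - 1))" (is "hausdorff_outer _ ?A \<le> _")
  unfolding hausdorff_outer_def
proof (rule SUP_least)
  fix \<delta> :: real assume "\<delta> \<in> {0<..}"
  then have \<delta>: "0 < \<delta>" by simp
  have d: "0 < real d" by (simp add: d_def)
  \<comment> \<open>The grid is made so fine that \<open>l\<close>, the bound for the diameter of a
    pulled-back cell, is at most \<open>\<delta>\<close>.\<close>
  obtain m :: nat where m: "4 * (real d)\<^sup>2 * \<rho> / \<delta> < real m" using reals_Archimedean2 by blast
  have m0: "0 < real m"
    using m \<open>0 < \<rho>\<close> \<delta> by (smt (verit) divide_nonneg_pos mult_nonneg_nonneg zero_le_power2)
  define l where "l = 4 * (real d)\<^sup>2 * \<rho> / m"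
  have l: "0 \<le> l" "l \<le> \<delta>"
    using m m0 \<delta> \<open>0 < \<rho>\<close> by (auto simp: l_def field_simps)
  define J where "J = (PiE (Basis - {b}) (\<lambda>_. {..<m}) :: ('a \<Rightarrow> nat) set)"
  define U where "U k = {x \<in> ?A. \<forall>i\<in>Basis - {b}. u \<bullet> i - \<rho> + 2 * \<rho> * real (k i) / real m \<le> x \<bullet> i \<and>
    x \<bullet> i \<le> u \<bullet> i - \<rho> + 2 * \<rho> * (real (k i) + 1) / real m}" for k
  have J: "finite J" "card J = m ^ (d - 1)"
    using b by (auto simp: J_def card_PiE d_def finite_PiE)
  have diam: "norm (x - y) \<le> l" if xy: "x \<in> U k" "y \<in> U k" for x y k
  proof -
    have i: "\<bar>x \<bullet> i - y \<bullet> i\<bar> \<le> 2 * \<rho> / m" if "i \<in> Basis - {b}" for i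
    proof -
      have "2 * \<rho> * (real (k i) + 1) / m = 2 * \<rho> * real (k i) / m + 2 * \<rho> / m"
        by (simp add: add_divide_distrib distrib_left)
      moreover have "u \<bullet> i - \<rho> + 2 * \<rho> * real (k i) / m \<le> x \<bullet> i \<and> x \<bullet> i \<le> u \<bullet> i - \<rho> + 2 * \<rho> * (real (k i) + 1) / m"
        "u \<bullet> i - \<rho> + 2 * \<rho> * real (k i) / m \<le> y \<bullet> i \<and> y \<bullet> i \<le> u \<bullet> i - \<rho> + 2 * \<rho> * (real (k i) + 1) / m"
        using xy that by (simp_all add: U_def)
      ultimately show ?thesis by linarith
    qed
    have n: "norm x = 1" "norm y = 1" using xy by (auto simp: U_def)
    have n2: "(\<Sum>i\<in>Basis. (x \<bullet> i)\<^sup>2) = 1" "(\<Sum>i\<in>Basis. (y \<bullet> i)\<^sup>2) = 1"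
      using n norm_eq_1[of x] norm_eq_1[of y]
      by (simp_all add: euclidean_inner[of x x] euclidean_inner[of y y] power2_eq_square)
    \<comment> \<open>On the sphere the squares of the coordinates sum to 1, so the change in the
      \<open>b\<close>-coordinate is controlled by the others; the difference of squares is then
      divided by the sum of the two \<open>b\<close>-coordinates.\<close>
    have "(x \<bullet> b)\<^sup>2 - (y \<bullet> b)\<^sup>2 = (\<Sum>i\<in>Basis - {b}. (y \<bullet> i)\<^sup>2 - (x \<bullet> i)\<^sup>2)"
      using n2 b by (simp add: sum_subtractf sum.remove[of Basis b])
    also have "\<bar>\<dots>\<bar> \<le> (\<Sum>i\<in>Basis - {b}. 4 * \<rho> / m)"
    proof (rule order_trans[OF sum_abs], intro sum_mono)
      fix i assume "i \<in> Basis - {b}"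
      then have "\<bar>x \<bullet> i - y \<bullet> i\<bar> * \<bar>y \<bullet> i + x \<bullet> i\<bar> \<le> 2 * \<rho> / m * 2"
        using i[of i] Basis_le_norm[of i x] Basis_le_norm[of i y] n m0 \<open>0 < \<rho>\<close>
        by (intro mult_mono) auto
      moreover have "(y \<bullet> i)\<^sup>2 - (x \<bullet> i)\<^sup>2 = - ((x \<bullet> i - y \<bullet> i) * (y \<bullet> i + x \<bullet> i))"
        by (simp add: power2_eq_square algebra_simps)
      ultimately show "\<bar>(y \<bullet> i)\<^sup>2 - (x \<bullet> i)\<^sup>2\<bar> \<le> 4 * \<rho> / m"
        by (simp add: abs_mult)
    qed
    also have "\<dots> = (real d - 1) * (4 * \<rho> / m)"
      using b by (simp add: d_def of_nat_diff Suc_leI)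
    also have "\<dots> \<le> real d * (4 * \<rho> / m)"
      using m0 \<open>0 < \<rho>\<close> by (intro mult_right_mono) auto
    finally have "\<bar>x \<bullet> b - y \<bullet> b\<bar> * \<bar>x \<bullet> b + y \<bullet> b\<bar> \<le> real d * (4 * \<rho> / m)"
      by (simp add: abs_mult[symmetric] power2_eq_square algebra_simps)
    \<comment> \<open>Both points lie on the same side, selected by \<open>\<sigma>\<close>, so
      their \<open>b\<close>-coordinates cannot cancel.\<close>
    moreover have "2 / real d \<le> \<bar>x \<bullet> b + y \<bullet> b\<bar>"
    proof -
      have "2 / real d \<le> \<sigma> * (x \<bullet> b + y \<bullet> b)"
        using xy by (simp add: U_def algebra_simps)
      also have "\<dots> \<le> \<bar>\<sigma> * (x \<bullet> b + y \<bullet> b)\<bar>" by simp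
      finally show ?thesis by (simp add: abs_mult \<sigma>)
    qed
    ultimately have "\<bar>x \<bullet> b - y \<bullet> b\<bar> * (2 / real d) \<le> real d * (4 * \<rho> / m)"
      by (meson abs_ge_zero mult_left_mono order_trans)
    then have xb: "\<bar>x \<bullet> b - y \<bullet> b\<bar> \<le> 2 * (real d)\<^sup>2 * \<rho> / m"
      using d m0 by (simp add: field_simps power2_eq_square)
    have "norm (x - y) \<le> (\<Sum>i\<in>Basis. \<bar>(x - y) \<bullet> i\<bar>)" by (rule norm_le_l1)
    also have "\<dots> = \<bar>x \<bullet> b - y \<bullet> b\<bar> + (\<Sum>i\<in>Basis - {b}. \<bar>x \<bullet> i - y \<bullet> i\<bar>)"
      using b by (simp add: sum.remove[of Basis b] inner_diff_left)
    also have "\<dots> \<le> 2 * (real d)\<^sup>2 * \<rho> / m + (\<Sum>i\<in>Basis - {b}. 2 * \<rho> / m)"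
      by (intro add_mono xb sum_mono i)
    also have "(\<Sum>i\<in>Basis - {b}. 2 * \<rho> / m) \<le> real d * (2 * \<rho> / m)"
      using b m0 \<open>0 < \<rho>\<close> by (simp add: d_def of_nat_diff Suc_leI mult_right_mono divide_right_mono)
    also have "real d * (2 * \<rho> / m) \<le> (real d)\<^sup>2 * (2 * \<rho> / m)"
      using m0 \<open>0 < \<rho>\<close> d by (intro mult_right_mono) (auto simp: power2_eq_square d_def Suc_leI)
    finally show ?thesis by (simp add: l_def field_simps)
  qed
  have U: "bounded (U k) \<and> diameter (U k) \<le> l" for k
  proof -
    have "bounded (U k)" by (rule bounded_subset[of "sphere 0 1"]) (auto simp: U_def)
    moreover have "diameter (U k) \<le> l"
      using diam l by (intro diameter_le) auto
    ultimately show ?thesis by simp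
  qed
  have cover: "?A \<subseteq> (\<Union>k\<in>J. U k)"
  proof
    fix x assume x: "x \<in> ?A"
    have "\<exists>k<m. u \<bullet> i - \<rho> + 2 * \<rho> * real k / real m \<le> x \<bullet> i \<and>
      x \<bullet> i \<le> u \<bullet> i - \<rho> + 2 * \<rho> * (real k + 1) / real m" if "i \<in> Basis" for i
    proof -
      have "\<bar>x \<bullet> i - u \<bullet> i\<bar> \<le> \<rho>"
        using x Basis_le_norm[OF that, of "x - u"]
        by (auto simp: inner_diff_left dist_norm norm_minus_commute)
      then show ?thesis using grid_index[of \<rho> m "x \<bullet> i" "u \<bullet> i"] \<open>0 < \<rho>\<close> m0 by fastforce
    qed
    then obtain k where "\<And>i. i \<in> Basis \<Longrightarrow> k i < m \<and> u \<bullet> i - \<rho> + 2 * \<rho> * real (k i) / real m \<le> x \<bullet> i \<and>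
      x \<bullet> i \<le> u \<bullet> i - \<rho> + 2 * \<rho> * (real (k i) + 1) / real m" by metis
    then have "x \<in> U (restrict k (Basis - {b}))" "restrict k (Basis - {b}) \<in> J"
      using x by (auto simp: U_def J_def)
    then show "x \<in> (\<Union>k\<in>J. U k)" by blast
  qed
  define w where "w = unit_ball_vol (real (d - 1)) * (l / 2) ^ (d - 1)"
  have "hausdorff_pre (d - 1) \<delta> ?A \<le> ennreal (real (card J) * w)"
  proof (rule hausdorff_pre_le_finite_cover[OF J(1) cover])
    show "0 \<le> w" using l by (simp add: w_def)
    fix k
    have "0 \<le> diameter (U k)" using U by (intro diameter_ge_0) auto
    then have "hausdorff_weight (d - 1) (U k) \<le> ennreal w"
      using U[of k] l by (auto simp: hausdorff_weight_def w_def intro!: ennreal_leI mult_left_mono power_mono)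
    then show "bounded (U k) \<and> diameter (U k) \<le> \<delta> \<and> hausdorff_weight (d - 1) (U k) \<le> ennreal w"
      using U[of k] l by auto
  qed (use \<delta> in auto)
  \<comment> \<open>The number of cells and their size cancel: the resulting bound depends neither
    on \<open>m\<close> nor on \<open>\<delta>\<close>.\<close>
  also have "real (card J) * w = unit_ball_vol (real (d - 1)) * (real m * (l / 2)) ^ (d - 1)"
    by (simp add: J w_def flip: power_mult_distrib)
  also have "real m * (l / 2) = 2 * (real d)\<^sup>2 * \<rho>"
    using m0 by (simp add: l_def)
  finally show "hausdorff_pre (d - 1) \<delta> ?A \<le> ennreal (unit_ball_vol (real (d - 1)) * (2 * (real d)\<^sup>2 * \<rho>) ^ (d - 1))" .
qed

text \<open>Each unit vector has a coordinate of absolute value at least \<open>1 / d\<close>, so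
  the \<open>2 * d\<close> patches given by a basis vector and a sign cover the cap.\<close>

lemma hausdorff_sphere_cap:
  obtains C where "0 < C"
    "\<And>(u::'a::euclidean_space) \<rho>. 0 < \<rho> \<Longrightarrow>
      emeasure (hausdorff_measure (DIM('a) - 1)) (sphere 0 1 \<inter> cball u \<rho>) \<le> ennreal (C * \<rho> ^ (DIM('a) - 1))"
proof -
  define d where "d = DIM('a)"
  define C where "C = unit_ball_vol (real (d - 1)) * (2 * (real d)\<^sup>2) ^ (d - 1)"
  let ?H = "hausdorff_measure (d - 1) :: 'a measure"
  have C: "0 < C" unfolding C_def by (intro mult_pos_pos unit_ball_vol_pos) (auto simp: d_def)
  have "emeasure ?H (sphere 0 1 \<inter> cball u \<rho>) \<le> ennreal ((2 * d * C) * \<rho> ^ (d - 1))"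
    if \<rho>: "0 < \<rho>" for u \<rho>
  proof -
    define A where "A = (\<lambda>(b, \<sigma>). {x \<in> sphere 0 1 \<inter> cball u \<rho>. 1 / real d \<le> \<sigma> * (x \<bullet> (b::'a))})"
    let ?I = "(Basis :: 'a set) \<times> {1, -1 :: real}"
    have Am: "A p \<in> sets borel" for p
    proof -
      have "A p = sphere 0 1 \<inter> cball u \<rho> \<inter> {x. snd p * (x \<bullet> fst p) \<ge> 1 / real d}"
        by (auto simp: A_def case_prod_beta)
      moreover have "closed {x. snd p * (x \<bullet> fst p) \<ge> 1 / real d}"
        by (intro closed_Collect_le continuous_intros)
      ultimately show ?thesis by (auto intro!: borel_closed closed_Int)
    qed
    have "sphere 0 1 \<inter> cball u \<rho> \<subseteq> (\<Union>p\<in>?I. A p)"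
    proof
      fix x assume x: "x \<in> sphere 0 1 \<inter> cball u \<rho>"
      then have "norm x = 1" by simp
      then obtain b where b: "b \<in> Basis" "1 / real DIM('a) \<le> \<bar>x \<bullet> b\<bar>"
        by (rule exists_large_coordinate)
      have "x \<in> A (b, if 0 \<le> x \<bullet> b then 1 else -1)"
        using x b by (auto simp: A_def d_def)
      then show "x \<in> (\<Union>p\<in>?I. A p)" using b(1) by (auto split: if_splits)
    qed
    then have "emeasure ?H (sphere 0 1 \<inter> cball u \<rho>) \<le> emeasure ?H (\<Union>p\<in>?I. A p)"
      using Am by (intro emeasure_mono) auto
    also have "\<dots> \<le> (\<Sum>p\<in>?I. emeasure ?H (A p))"
      using Am by (intro emeasure_subadditive_finite) auto
    also have "\<dots> \<le> (\<Sum>p\<in>?I. ennreal (C * \<rho> ^ (d - 1)))"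
    proof (intro sum_mono)
      fix p assume "p \<in> ?I"
      then obtain b \<sigma> where p: "p = (b, \<sigma>)" "b \<in> Basis" "\<bar>\<sigma>\<bar> = 1" by auto
      show "emeasure ?H (A p) \<le> ennreal (C * \<rho> ^ (d - 1))"
        unfolding emeasure_hausdorff[OF Am]
        using hausdorff_outer_sphere_patch[OF p(2) \<rho> p(3), of u]
        by (simp add: p(1) A_def d_def C_def power_mult_distrib mult.assoc)
    qed
    also have "\<dots> = ennreal ((2 * d * C) * \<rho> ^ (d - 1))"
      using C \<rho> by (simp add: card_cartesian_product d_def ennreal_of_nat_eq_real_of_nat ennreal_mult[symmetric] algebra_simps)
    finally show ?thesis .
  qed
  then show ?thesis using C that[of "2 * d * C"] by (simp add: d_def)
qed

text \<open>Surface measure as a finite Borel measure \<open>N\<close> on the whole space,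
  concentrated on the sphere. Set integrals become plain integrals, and the rest of the proof uses
  only the properties listed here.\<close>

lemma normalised_sphere_measure:
  obtains N :: "'a::euclidean_space measure" and C where "0 < C" "sets N = sets borel" "finite_measure N"
    "AE u in N. norm u = 1"
    "\<And>u \<rho>. 0 < \<rho> \<Longrightarrow> emeasure N (cball u \<rho>) \<le> ennreal (C * \<rho> ^ (DIM('a) - 1))"
    "\<And>f. f \<in> borel_measurable borel \<Longrightarrow>
      (LINT u:sphere 0 1|hausdorff_measure (DIM('a) - 1). f u :: real) = (\<integral>u. f u \<partial>N)"
proof -
  let ?H = "hausdorff_measure (DIM('a) - 1) :: 'a measure"
  obtain C where C: "0 < C" "\<And>(u::'a) \<rho>. 0 < \<rho> \<Longrightarrow>
      emeasure ?H (sphere 0 1 \<inter> cball u \<rho>) \<le> ennreal (C * \<rho> ^ (DIM('a) - 1))"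
    by (rule hausdorff_sphere_cap) blast
  define N where "N = density ?H (\<lambda>u. ennreal (indicator (sphere 0 1) u))"
  have [measurable]: "sphere 0 1 \<in> sets ?H" by (simp add: borel_closed)
  have sets: "sets N = sets borel" by (simp add: N_def)
  have em: "emeasure N A = emeasure ?H (sphere 0 1 \<inter> A)" if "A \<in> sets borel" for A
  proof -
    have "emeasure N A = (\<integral>\<^sup>+u. ennreal (indicator (sphere 0 1) u) * indicator A u \<partial>?H)"
      unfolding N_def using that by (subst emeasure_density) auto
    also have "\<dots> = (\<integral>\<^sup>+u. indicator (sphere 0 1 \<inter> A) u \<partial>?H)"
      by (intro nn_integral_cong) (auto split: split_indicator)
    also have "\<dots> = emeasure ?H (sphere 0 1 \<inter> A)"
      using that by (intro nn_integral_indicator) (auto simp: borel_closed)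
    finally show ?thesis .
  qed
  have "emeasure N (space N) = emeasure ?H (sphere 0 1 \<inter> UNIV)"
    using em[of UNIV] sets_eq_imp_space_eq[OF sets] by simp
  \<comment> \<open>The whole sphere is itself a cap, with centre 0 and radius 1; hence the cap
    bound gives finiteness.\<close>
  also have "sphere 0 1 \<inter> UNIV = sphere 0 1 \<inter> cball (0::'a) 1" by auto
  also have "emeasure ?H \<dots> \<le> ennreal (C * 1 ^ (DIM('a) - 1))" by (rule C(2)) simp
  finally have "finite_measure N" by (intro finite_measureI) (auto simp: top_unique)
  moreover have "AE u in N. norm u = 1"
    unfolding N_def by (subst AE_density) (auto split: split_indicator)
  moreover have "emeasure N (cball u \<rho>) \<le> ennreal (C * \<rho> ^ (DIM('a) - 1))" if "0 < \<rho>" for u \<rho>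
    using C(2)[OF that] by (simp add: em borel_closed)
  moreover have "(LINT u:sphere 0 1|?H. f u :: real) = (\<integral>u. f u \<partial>N)" if "f \<in> borel_measurable borel" for f
  proof -
    have "f \<in> borel_measurable ?H" using that by simp
    then show ?thesis
      unfolding N_def set_lebesgue_integral_def by (subst integral_density) auto
  qed
  ultimately show ?thesis using that[OF C(1) sets] by blast
qed

section \<open>Bodies in which a ball rolls freely\<close>

text \<open>The two factors are those of a cap of height \<open>t\<close>: a base of radius of order
  \<open>sqrt t\<close> in dimension \<open>d - 1\<close>, times the height.\<close>

lemma powr_half_dim:
  assumes "0 \<le> t" "1 \<le> d"
  shows "t powr ((real d + 1) / 2) = sqrt t ^ (d - 1) * t"
proof (cases "t = 0")
  case False
  then have t: "0 < t" using assms by simp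
  have "sqrt t ^ (d - 1) = t powr ((real d - 1) / 2)"
    using t assms by (simp add: powr_half_sqrt[symmetric] powr_power of_nat_diff)
  then have "sqrt t ^ (d - 1) * t = t powr ((real d - 1) / 2) * t powr 1" using t by simp
  also have "\<dots> = t powr ((real d + 1) / 2)"
    unfolding powr_add[symmetric] by (simp add: field_simps)
  finally show ?thesis by simp
next
  case True
  then show ?thesis by simp
qed

text \<open>The cap contains a grid of disjoint cubes of side \<open>\<tau>\<close>, indexed by the hyperplane orthogonal to a
  coordinate direction \<open>b\<close> that is not almost orthogonal to \<open>u\<close>; the shifts along \<open>b\<close> put the centres
  on a hyperplane orthogonal to \<open>u\<close>.\<close>

lemma ball_cap_volume:
  fixes u p :: "'a::euclidean_space"
  defines "d \<equiv> DIM('a)"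
  assumes u: "norm u = 1" and r: "0 < r" and t: "0 < t" "t \<le> r / (8 * (real d)\<^sup>2)"
  shows "ennreal ((sqrt (r / 2) / (8 * (real d)\<^sup>2)) ^ (d - 1) / (2 * real d) * t powr ((real d + 1) / 2))
    \<le> emeasure lborel {x \<in> cball (p - r *\<^sub>R u) r. u \<bullet> (p - x) \<le> t}" (is "_ \<le> emeasure _ ?cap")
proof -
  have d: "1 \<le> real d" by (simp add: d_def Suc_leI)
  obtain b where b: "b \<in> Basis" and ub: "1 / real d \<le> \<bar>u \<bullet> b\<bar>"
    using exists_large_coordinate[OF u] unfolding d_def by blast
  \<comment> \<open>With this side a point of a cube is at distance at most \<open>t / 4\<close>
    from the centre, so centres at depth \<open>t / 2\<close> below \<open>p\<close> keep the cube
    between the depths \<open>t / 4\<close> and \<open>t\<close>.\<close>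
  define \<tau> where "\<tau> = t / (2 * real d)"
  \<comment> \<open>A point \<open>x\<close> lies in the ball iff the square of
    \<open>norm (x - p)\<close> is at most \<open>2 * r * (u \<bullet> (p - x))\<close>. At depth at
    least \<open>t / 4\<close> this holds within distance \<open>s\<close> of
    \<open>p\<close>.\<close>
  define s where "s = sqrt (r * t / 2)"
  have \<tau>: "0 < \<tau>" "real d * \<tau> = t / 2" using t d by (auto simp: \<tau>_def)
  have s2: "s\<^sup>2 = r * t / 2" using r t by (simp add: s_def)
  have s0: "0 < s" using r t by (simp add: s_def)
  have ts: "2 * real d * t \<le> s"
  proof (rule power2_le_imp_le)
    have "4 * (real d)\<^sup>2 * t \<le> r / 2" using t d by (simp add: field_simps)
    then have "4 * (real d)\<^sup>2 * t * t \<le> r / 2 * t" using t by (intro mult_right_mono) auto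
    then show "(2 * real d * t)\<^sup>2 \<le> s\<^sup>2"
      unfolding s2 by (simp add: power2_eq_square algebra_simps)
  qed (use s0 in auto)
  \<comment> \<open>The extent of the grid in each coordinate. It makes both the displacement
    \<open>y k\<close> and the part of the shift \<open>e k\<close> caused by it at most
    \<open>s / 4\<close> in norm.\<close>
  define q where "q = s / (4 * (real d)\<^sup>2)"
  define m where "m = nat \<lfloor>q / \<tau>\<rfloor>"
  \<comment> \<open>At least one cell fits into the extent, so rounding down to \<open>m\<close>
    loses at most a factor 2.\<close>
  have q1: "1 \<le> q / \<tau>"
    using ts t d by (simp add: q_def \<tau>_def field_simps power2_eq_square)
  have m: "real m * \<tau> \<le> q" "q / 2 \<le> real m * \<tau>"
  proof -
    have *: "real m \<le> q / \<tau>" "q / \<tau> < real m + 1" "1 \<le> real m"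
      using q1 by (auto simp: m_def le_nat_floor)
    then show "real m * \<tau> \<le> q" using \<tau> by (simp add: field_simps)
    have "q / \<tau> \<le> 2 * real m" using * by linarith
    then show "q / 2 \<le> real m * \<tau>" using \<tau> by (simp add: field_simps)
  qed
  define J where "J = (PiE (Basis - {b}) (\<lambda>_. {..<m}) :: ('a \<Rightarrow> nat) set)"
  have J: "finite J" "card J = m ^ (d - 1)"
    using b by (auto simp: J_def card_PiE d_def finite_PiE)
  define y where "y k = (\<Sum>i\<in>Basis - {b}. (real (k i) * \<tau>) *\<^sub>R i)" for k :: "'a \<Rightarrow> nat"
  \<comment> \<open>The shift along \<open>b\<close> that brings the centre to depth exactly
    \<open>t / 2\<close>; dividing by \<open>u \<bullet> b\<close> costs at most a factor
    \<open>d\<close>.\<close>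
  define e where "e k = - (t / 2 + u \<bullet> y k) / (u \<bullet> b)" for k
  define z where "z k = p + y k + e k *\<^sub>R b" for k
  define Q where "Q k = box (z k - (\<tau> / 2) *\<^sub>R One) (z k + (\<tau> / 2) *\<^sub>R One)" for k
  have ub0: "u \<bullet> b \<noteq> 0" using ub d by auto
  have uz: "u \<bullet> (p - z k) = t / 2" for k
    using ub0 by (simp add: z_def e_def inner_simps)
  have yi: "y k \<bullet> i = real (k i) * \<tau>" if "i \<in> Basis - {b}" for k i
  proof -
    have "y k \<bullet> i = (\<Sum>j\<in>Basis - {b}. if j = i then real (k i) * \<tau> else 0)"
      unfolding y_def inner_sum_left using that
      by (intro sum.cong) (auto simp: inner_Basis)
    then show ?thesis using that by simp
  qed
  have zi: "z k \<bullet> i = p \<bullet> i + real (k i) * \<tau>" if "i \<in> Basis - {b}" for k i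
    using yi[OF that] that b by (auto simp: z_def inner_simps inner_Basis)
  have Qi: "\<bar>x \<bullet> i - z k \<bullet> i\<bar> < \<tau> / 2" if "x \<in> Q k" "i \<in> Basis" for x k i
    using that by (auto simp: Q_def box_def inner_simps abs_if dest!: bspec)
  have "Q k \<subseteq> ?cap" if k: "k \<in> J" for k
  proof
    fix x assume x: "x \<in> Q k"
    have "norm (x - z k) \<le> (\<Sum>i\<in>Basis. \<bar>(x - z k) \<bullet> i\<bar>)" by (rule norm_le_l1)
    also have "\<dots> \<le> (\<Sum>i\<in>(Basis :: 'a set). \<tau> / 2)"
      using Qi[OF x] by (intro sum_mono) (simp add: inner_diff_left less_imp_le)
    also have "\<dots> = t / 4" using \<tau>(2) by (simp add: d_def mult.commute)
    finally have xz: "norm (x - z k) \<le> t / 4" .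
    have "\<bar>u \<bullet> (x - z k)\<bar> \<le> t / 4"
      using Cauchy_Schwarz_ineq2[of u "x - z k"] u xz by simp
    moreover have "u \<bullet> (p - x) = t / 2 - u \<bullet> (x - z k)"
      using uz[of k] by (simp add: inner_simps)
    ultimately have upx: "t / 4 \<le> u \<bullet> (p - x)" "u \<bullet> (p - x) \<le> t" using t by linarith+
    have "norm (y k) \<le> (\<Sum>i\<in>Basis - {b}. norm ((real (k i) * \<tau>) *\<^sub>R i))"
      unfolding y_def by (rule norm_sum)
    also have "\<dots> \<le> (\<Sum>i\<in>Basis - {b}. q)"
    proof (intro sum_mono)
      fix i assume i: "i \<in> Basis - {b}"
      then have "k i < m" using k by (auto simp: J_def PiE_def Pi_def)
      then have "real (k i) * \<tau> \<le> real m * \<tau>" using \<tau> by (intro mult_right_mono) auto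
      then have "real (k i) * \<tau> \<le> q" using m(1) by linarith
      then show "norm ((real (k i) * \<tau>) *\<^sub>R i) \<le> q" using i \<tau> by simp
    qed
    also have "\<dots> = (real d - 1) * q"
      using b by (simp add: d_def of_nat_diff Suc_leI)
    also have "\<dots> \<le> real d * q"
      using s0 by (intro mult_right_mono) (auto simp: q_def)
    finally have yk: "norm (y k) \<le> real d * q" .
    have "\<bar>e k\<bar> = \<bar>t / 2 + u \<bullet> y k\<bar> / \<bar>u \<bullet> b\<bar>" by (simp only: e_def abs_divide abs_minus_cancel)
    also have "\<dots> \<le> (t / 2 + real d * q) / (1 / real d)"
    proof (rule frac_le)
      have "\<bar>u \<bullet> y k\<bar> \<le> real d * q"
        using Cauchy_Schwarz_ineq2[of u "y k"] u yk by simp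
      then show "\<bar>t / 2 + u \<bullet> y k\<bar> \<le> t / 2 + real d * q" using t by linarith
      show "0 \<le> t / 2 + real d * q" using t s0 by (simp add: q_def)
    qed (use ub d in auto)
    finally have ek: "\<bar>e k\<bar> \<le> real d * t / 2 + (real d)\<^sup>2 * q"
      by (simp add: algebra_simps power2_eq_square)
    have dq: "real d * q \<le> s / 4" "(real d)\<^sup>2 * q = s / 4"
      using s0 d by (auto simp: q_def field_simps power2_eq_square)
    have "norm (x - p) = norm ((x - z k) + y k + e k *\<^sub>R b)" by (simp add: z_def)
    also have "\<dots> \<le> norm (x - z k) + norm (y k) + norm (e k *\<^sub>R b)"
      by (intro order_trans[OF norm_triangle_ineq] add_right_mono norm_triangle_ineq)
    also have "\<dots> \<le> t / 4 + s / 4 + (real d * t / 2 + s / 4)"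
      using xz yk ek dq b by simp
    also have "\<dots> \<le> s"
    proof -
      have "t \<le> real d * t" using t d by simp
      then show ?thesis using ts s0 by linarith
    qed
    finally have "(norm (x - p))\<^sup>2 \<le> s\<^sup>2" by (intro power_mono) auto
    also have "\<dots> \<le> 2 * r * (u \<bullet> (p - x))"
      using upx r by (simp add: s2 field_simps)
    finally have le: "(norm (x - p))\<^sup>2 \<le> 2 * r * (u \<bullet> (p - x))" .
    have "(norm ((x - p) + r *\<^sub>R u))\<^sup>2 = (norm (x - p))\<^sup>2 + 2 * ((x - p) \<bullet> (r *\<^sub>R u)) + (norm (r *\<^sub>R u))\<^sup>2"
      unfolding power2_norm_eq_inner by (simp add: inner_simps inner_commute)
    also have "\<dots> = (norm (x - p))\<^sup>2 - 2 * r * (u \<bullet> (p - x)) + r\<^sup>2"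
      using u by (simp add: inner_simps inner_commute algebra_simps)
    also have "\<dots> \<le> r\<^sup>2" using le by simp
    finally have "norm ((x - p) + r *\<^sub>R u) \<le> r" by (rule power2_le_imp_le) (use r in simp)
    moreover have "dist (p - r *\<^sub>R u) x = norm ((x - p) + r *\<^sub>R u)"
      by (simp add: dist_norm norm_minus_commute algebra_simps)
    ultimately show "x \<in> ?cap" using upx by simp
  qed
  then have sub: "(\<Union>k\<in>J. Q k) \<subseteq> ?cap" by blast
  \<comment> \<open>Different indices differ in a coordinate other than \<open>b\<close>, which the
    shifts leave alone; there the centres are at least \<open>\<tau>\<close> apart.\<close>
  have disj: "disjoint_family_on Q J"
    unfolding disjoint_family_on_def
  proof safe
    fix k l x assume kl: "k \<in> J" "l \<in> J" "k \<noteq> l" and x: "x \<in> Q k" "x \<in> Q l"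
    then obtain i where i: "i \<in> Basis - {b}" "k i \<noteq> l i"
      unfolding J_def by (metis PiE_ext)
    have "\<bar>real (k i) * \<tau> - real (l i) * \<tau>\<bar> < \<tau>"
      using Qi[OF x(1), of i] Qi[OF x(2), of i] i(1) zi[OF i(1), of k] zi[OF i(1), of l]
      by (simp add: abs_if split: if_splits)
    then have "\<bar>real (k i) - real (l i)\<bar> * \<tau> < 1 * \<tau>"
      using \<tau> by (simp add: left_diff_distrib[symmetric] abs_mult)
    then have "\<bar>real (k i) - real (l i)\<bar> < 1" using \<tau> mult_less_cancel_right_pos by blast
    then show "x \<in> {}" using i(2) by linarith
  qed
  have Qm: "Q k \<in> sets lborel" for k by (simp add: Q_def)
  have vol: "emeasure lborel (Q k) = ennreal (\<tau> ^ d)" for k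
    unfolding Q_def using \<tau>
    by (subst emeasure_lborel_box) (auto simp: inner_simps d_def)
  \<comment> \<open>The constant is that of \<open>q / 2\<close> with its factor
    \<open>sqrt t\<close> split off, to the power \<open>d - 1\<close>, times
    \<open>\<tau> / t\<close>.\<close>
  have "(sqrt (r / 2) / (8 * (real d)\<^sup>2)) ^ (d - 1) / (2 * real d) * t powr ((real d + 1) / 2)
      = (q / 2) ^ (d - 1) * \<tau>"
  proof -
    have "sqrt (r * t / 2) = sqrt (r / 2) * sqrt t" by (simp flip: real_sqrt_mult)
    then have "q / 2 = sqrt (r / 2) / (8 * (real d)\<^sup>2) * sqrt t" by (simp add: q_def s_def)
    then show ?thesis
      using t by (simp add: powr_half_dim d_def Suc_leI \<tau>_def power_mult_distrib power_divide)
  qed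
  also have "\<dots> \<le> (real m * \<tau>) ^ (d - 1) * \<tau>"
    using m s0 \<tau> by (intro mult_right_mono power_mono) (auto simp: q_def)
  also have "\<dots> = real (card J) * \<tau> ^ d"
    by (cases d) (use d in \<open>auto simp: J power_mult_distrib\<close>)
  finally have "ennreal ((sqrt (r / 2) / (8 * (real d)\<^sup>2)) ^ (d - 1) / (2 * real d) * t powr ((real d + 1) / 2))
      \<le> ennreal (real (card J) * \<tau> ^ d)" by (rule ennreal_leI)
  also have "\<dots> = (\<Sum>k\<in>J. emeasure lborel (Q k))"
    using \<tau> by (simp add: vol ennreal_mult ennreal_of_nat_eq_real_of_nat)
  also have "\<dots> = emeasure lborel (\<Union>k\<in>J. Q k)"
    using disj J Qm by (intro sum_emeasure) auto
  also have "\<dots> \<le> emeasure lborel ?cap"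
  proof (intro emeasure_mono sub)
    have "?cap = cball (p - r *\<^sub>R u) r \<inter> {x. u \<bullet> (p - x) \<le> t}" by auto
    moreover have "closed {x. u \<bullet> (p - x) \<le> t}" by (intro closed_Collect_le continuous_intros)
    ultimately show "?cap \<in> sets lborel" by (auto intro!: borel_closed closed_Int)
  qed
  finally show ?thesis .
qed

section \<open>Touching balls and the position of points relative to inscribed balls\<close>

lemma inner_le_support_fun:
  assumes "bounded K" "x \<in> K"
  shows "u \<bullet> x \<le> support_fun K u"
  unfolding support_fun_def
proof (rule cSUP_upper[OF assms(2)])
  obtain B where B: "\<And>x. x \<in> K \<Longrightarrow> norm x \<le> B" using assms(1) by (auto simp: bounded_iff)
  show "bdd_above ((\<bullet>) u ` K)"
  proof (rule bdd_aboveI2)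
    fix x assume "x \<in> K"
    then show "u \<bullet> x \<le> norm u * B"
      using norm_cauchy_schwarz[of u x] B[of x] mult_left_mono[of "norm x" B "norm u"] by simp
  qed
qed

text \<open>At a maximiser \<open>p\<close> of \<open>u\<close> the rolling ball has only one
  possible position. Its point farthest in direction \<open>u\<close> stays below \<open>p\<close>,
  so \<open>u \<bullet> (p - v)\<close> is at least \<open>r\<close>; as \<open>p - v\<close> has
  norm at most \<open>r\<close>, it equals \<open>r *\<^sub>R u\<close>.\<close>

lemma rolls_freely_touching:
  fixes K :: "'a::euclidean_space set"
  assumes "compact K" "K \<noteq> {}" "rolls_freely_in (cball 0 r) K" and u: "norm u = 1"
  obtains p where "p \<in> frontier K" "u \<bullet> p = support_fun K u" "cball (p - r *\<^sub>R u) r \<subseteq> K"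
proof -
  have bK: "bounded K" using assms compact_imp_bounded by blast
  obtain p where p: "p \<in> K" "\<And>x. x \<in> K \<Longrightarrow> u \<bullet> x \<le> u \<bullet> p"
    using continuous_attains_sup[OF assms(1,2), of "\<lambda>x. u \<bullet> x"]
    by (auto simp: continuous_on_inner continuous_on_const continuous_on_id)
  have h: "support_fun K u = u \<bullet> p"
    unfolding support_fun_def by (rule cSup_eq_maximum) (use p in auto)
  have uu: "u \<bullet> u = 1" using u by (simp add: norm_eq_1)
  have "p \<notin> interior K"
  proof
    assume "p \<in> interior K"
    then obtain e where e: "0 < e" "cball p e \<subseteq> K" by (auto simp: mem_interior_cball)
    then have "p + e *\<^sub>R u \<in> K" using u by (auto simp: dist_norm subset_iff)
    then show False using p(2)[of "p + e *\<^sub>R u"] e uu by (simp add: inner_simps)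
  qed
  then have pf: "p \<in> frontier K"
    using p(1) assms(1) by (simp add: frontier_def compact_imp_closed)
  then obtain v where "p \<in> (+) v ` cball 0 r" "(+) v ` cball 0 r \<subseteq> K"
    using assms(3) by (auto simp: rolls_freely_in_def)
  then have v: "p \<in> cball v r" "cball v r \<subseteq> K" by (simp_all add: cball_translation[symmetric])
  have r: "0 \<le> r" using v(1) zero_le_dist[of v p] unfolding mem_cball by linarith
  have "v + r *\<^sub>R u \<in> K" using v(2) u r by (auto simp: dist_norm subset_iff)
  then have "r \<le> u \<bullet> (p - v)" using p(2)[of "v + r *\<^sub>R u"] uu by (simp add: inner_simps)
  then have 1: "r * r \<le> r * (u \<bullet> (p - v))" using r by (rule mult_left_mono)
  have "norm (p - v) \<le> r" using v(1) by (simp add: dist_norm norm_minus_commute)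
  then have 2: "(norm (p - v))\<^sup>2 \<le> r * r"
    using power_mono[of "norm (p - v)" r 2] by (simp add: power2_eq_square)
  have "(norm (p - v - r *\<^sub>R u))\<^sup>2 = (norm (p - v))\<^sup>2 - 2 * (r * (u \<bullet> (p - v))) + r * r"
    unfolding power2_norm_eq_inner
    by (simp add: inner_simps inner_commute uu algebra_simps)
  then have "(norm (p - v - r *\<^sub>R u))\<^sup>2 \<le> 0" using 1 2 by linarith
  then have "v = p - r *\<^sub>R u" by (simp add: algebra_simps)
  then show ?thesis using that[of p] pf h v by simp
qed

text \<open>The centres of the balls of radius \<open>r\<close> contained in \<open>K\<close> form a convex set, hence so does the union
  of these balls; containing the frontier of \<open>K\<close>, it is all of \<open>K\<close>.\<close>

lemma rolls_freely_slack:
  fixes K :: "'a::euclidean_space set"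
  assumes "compact K" "convex K" "rolls_freely_in (cball 0 r) K" "x \<in> K" "0 \<le> r"
  obtains w where "norm w \<le> r" "\<And>u. norm u = 1 \<Longrightarrow> r - u \<bullet> w \<le> support_fun K u - u \<bullet> x"
proof -
  define L where "L = {v. cball v r \<subseteq> K}"
  have shift: "v + w \<in> K" if "v \<in> L" "norm w \<le> r" for v w
    using that by (auto simp: L_def dist_norm subset_iff)
  have "convex L"
    unfolding convex_alt
  proof safe
    fix v v' and a :: real assume v: "v \<in> L" "v' \<in> L" and a: "0 \<le> a" "a \<le> 1"
    have "(1 - a) *\<^sub>R v + a *\<^sub>R v' + w \<in> K" if "norm w \<le> r" for w
    proof -
      have "(1 - a) *\<^sub>R (v + w) + a *\<^sub>R (v' + w) \<in> K"
        using assms(2) shift[OF v(1) that] shift[OF v(2) that] a by (auto simp: convex_alt)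
      then show ?thesis by (simp add: algebra_simps)
    qed
    from this[of "_ - ((1 - a) *\<^sub>R v + a *\<^sub>R v')"]
    show "(1 - a) *\<^sub>R v + a *\<^sub>R v' \<in> L"
      by (auto simp: L_def dist_norm norm_minus_commute)
  qed
  moreover have "{v + w |v w. v \<in> L \<and> w \<in> cball 0 r} = (\<Union>v\<in>L. \<Union>w\<in>cball 0 r. {v + w})"
    by blast
  ultimately have "convex {v + w |v w. v \<in> L \<and> w \<in> cball 0 r}"
    using convex_sums[of L "cball 0 r"] by simp
  moreover have "frontier K \<subseteq> {v + w |v w. v \<in> L \<and> w \<in> cball 0 r}"
  proof
    fix p assume "p \<in> frontier K"
    then obtain v where v: "p \<in> (+) v ` cball 0 r" "(+) v ` cball 0 r \<subseteq> K"
      using assms(3) by (auto simp: rolls_freely_in_def)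
    then have "v \<in> L" by (simp add: L_def cball_translation[symmetric])
    then show "p \<in> {v + w |v w. v \<in> L \<and> w \<in> cball 0 r}" using v(1) by blast
  qed
  ultimately have "convex hull (frontier K) \<subseteq> {v + w |v w. v \<in> L \<and> w \<in> cball 0 r}"
    by (intro hull_minimal)
  then have "K \<subseteq> {v + w |v w. v \<in> L \<and> w \<in> cball 0 r}"
    using Krein_Milman_frontier[OF assms(2,1)] by simp
  then obtain v w where vw: "x = v + w" "v \<in> L" "norm w \<le> r" using assms(4) by auto
  \<comment> \<open>The ball about \<open>v\<close> reaches the height
    \<open>u \<bullet> v + r\<close>, while \<open>x\<close> has height
    \<open>u \<bullet> v + u \<bullet> w\<close>. The same \<open>w\<close> serves all
    directions.\<close>
  have "r - u \<bullet> w \<le> support_fun K u - u \<bullet> x" if "norm u = 1" for u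
  proof -
    have "u \<bullet> (v + r *\<^sub>R u) \<le> support_fun K u"
      by (intro inner_le_support_fun shift compact_imp_bounded assms vw) (use that assms in auto)
    moreover have "u \<bullet> u = 1" using that by (simp add: norm_eq_1)
    ultimately show ?thesis by (simp add: vw(1) inner_simps)
  qed
  then show ?thesis using that vw by blast
qed

text \<open>Both directions are close to the one vector \<open>w / r\<close>: expanding the square
  of the distance and using \<open>norm w \<le> r\<close> gives at most \<open>2 * t / r\<close>.
  The triangle inequality then compares \<open>u\<close> with \<open>v\<close>.\<close>

lemma directions_close:
  fixes w u v :: "'a::euclidean_space"
  assumes "0 < r" "norm w \<le> r" "norm u = 1" "norm v = 1" "r - u \<bullet> w \<le> t" "r - v \<bullet> w \<le> t"
  shows "dist u v \<le> sqrt (8 * t / r)"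
proof -
  have *: "dist a ((1 / r) *\<^sub>R w) \<le> sqrt (2 * t / r)" if "norm a = 1" "r - a \<bullet> w \<le> t" for a
  proof (rule real_le_rsqrt)
    have "(norm w)\<^sup>2 \<le> r\<^sup>2" using assms by (intro power_mono) auto
    then have w: "w \<bullet> w \<le> r * r" unfolding power2_norm_eq_inner by (simp add: power2_eq_square)
    have "(dist a ((1 / r) *\<^sub>R w))\<^sup>2 = a \<bullet> a - 2 * (a \<bullet> w) / r + w \<bullet> w / (r * r)"
      by (simp add: dist_norm power2_norm_eq_inner inner_simps inner_commute field_simps)
    also have "\<dots> \<le> 1 - 2 * (r - t) / r + 1"
      using w that assms(1) by (intro add_mono diff_mono divide_right_mono) (auto simp: norm_eq_1)
    also have "\<dots> = 2 * t / r" using assms(1) by (simp add: field_simps)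
    finally show "(dist a ((1 / r) *\<^sub>R w))\<^sup>2 \<le> 2 * t / r" .
  qed
  have "dist u v \<le> 2 * sqrt (2 * t / r)"
    using *[of u] *[of v] assms dist_triangle2[of u v "(1 / r) *\<^sub>R w"] by simp
  also have "\<dots> = sqrt (8 * t / r)"
    using real_sqrt_mult[of 4 "2 * t / r"] by simp
  finally show ?thesis .
qed

section \<open>The smallest gap of independent points\<close>

text \<open>Positivity and continuity are given only pointwise on the frontier; its compactness
  makes both the neighbourhood and the lower bound uniform. Covering by balls of half the radius
  leaves room for the triangle inequality.\<close>

lemma density_bounded_below_near_frontier:
  fixes K :: "'a::euclidean_space set" and \<rho> :: "'a \<Rightarrow> real"
  assumes "compact K" and pos: "\<forall>p\<in>frontier K. 0 < \<rho> p \<and> continuous (at p within K) \<rho>"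
  obtains \<epsilon> \<rho>0 where "0 < \<epsilon>" "0 < \<rho>0"
    "\<And>x p. x \<in> K \<Longrightarrow> p \<in> frontier K \<Longrightarrow> dist x p < \<epsilon> \<Longrightarrow> \<rho>0 \<le> \<rho> x"
proof -
  have "\<exists>\<delta>>0. \<forall>x\<in>K. dist x p < \<delta> \<longrightarrow> dist (\<rho> x) (\<rho> p) < \<rho> p / 2" if "p \<in> frontier K" for p
  proof -
    have "continuous (at p within K) \<rho>" "0 < \<rho> p / 2" using pos that by auto
    then show ?thesis unfolding continuous_within_eps_delta by blast
  qed
  then obtain \<delta> where \<delta>: "\<And>p. p \<in> frontier K \<Longrightarrow> 0 < \<delta> p"
    "\<And>p x. p \<in> frontier K \<Longrightarrow> x \<in> K \<Longrightarrow> dist x p < \<delta> p \<Longrightarrow> dist (\<rho> x) (\<rho> p) < \<rho> p / 2"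
    by metis
  have "compact (frontier K)" using assms(1) by (rule compact_frontier)
  then obtain F where F: "F \<subseteq> frontier K" "finite F" "frontier K \<subseteq> (\<Union>p\<in>F. ball p (\<delta> p / 2))"
  proof (rule compactE_image[where f="\<lambda>p. ball p (\<delta> p / 2)"])
    show "frontier K \<subseteq> (\<Union>p\<in>frontier K. ball p (\<delta> p / 2))" using \<delta>(1) by fastforce
  qed auto
  \<comment> \<open>The inserted 1 keeps the minimum meaningful if \<open>F\<close> is
    empty.\<close>
  define \<epsilon> where "\<epsilon> = Min (insert 1 ((\<lambda>p. \<delta> p / 2) ` F))"
  define \<rho>0 where "\<rho>0 = Min (insert 1 ((\<lambda>p. \<rho> p / 2) ` F))"
  have "0 < \<epsilon>" "0 < \<rho>0"
    using F \<delta>(1) pos by (auto simp: \<epsilon>_def \<rho>0_def)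
  moreover have "\<rho>0 \<le> \<rho> x" if x: "x \<in> K" "p \<in> frontier K" "dist x p < \<epsilon>" for x p
  proof -
    obtain q where q: "q \<in> F" "dist q p < \<delta> q / 2" using F(3) x(2) by auto
    have "\<epsilon> \<le> \<delta> q / 2" unfolding \<epsilon>_def using q F(2) by (intro Min_le) auto
    then have "dist x q < \<delta> q" using dist_triangle2[of x q p] q x(3) by linarith
    then have "dist (\<rho> x) (\<rho> q) < \<rho> q / 2" using \<delta>(2) q F(1) x(1) by blast
    then have "\<rho> q / 2 \<le> \<rho> x" by (simp add: dist_real_def abs_if split: if_splits)
    moreover have "\<rho>0 \<le> \<rho> q / 2" unfolding \<rho>0_def using q F(2) by (intro Min_le) auto
    ultimately show ?thesis by linarith
  qed
  ultimately show ?thesis using that by blast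
qed

lemma prob_space_density_on:
  assumes "prob_density_on K \<rho>"
  shows "prob_space (density (lebesgue_on K) (\<lambda>x. ennreal (\<rho> x)))"
proof (rule prob_spaceI)
  have "(\<lambda>x. ennreal (\<rho> x)) \<in> borel_measurable (lebesgue_on K)"
    using assms by (auto simp: prob_density_on_def)
  then have "emeasure (density (lebesgue_on K) (\<lambda>x. ennreal (\<rho> x))) (space (lebesgue_on K))
      = (\<integral>\<^sup>+x. ennreal (\<rho> x) \<partial>lebesgue_on K)"
    by (subst emeasure_density) (auto intro!: nn_integral_cong)
  then show "emeasure (density (lebesgue_on K) (\<lambda>x. ennreal (\<rho> x)))
      (space (density (lebesgue_on K) (\<lambda>x. ennreal (\<rho> x)))) = 1"
    using assms unfolding space_density by (simp only: prob_density_on_def)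
qed

lemma ident_borel_measurable_density:
  "(\<lambda>x. x) \<in> borel_measurable (density (lebesgue_on K) f)"
proof -
  have "(\<lambda>x. x) \<in> borel_measurable (lebesgue_on K)"
    by (intro measurable_restrict_space1) (simp add: measurable_completion)
  then show ?thesis by (subst measurable_cong_sets[OF sets_density refl])
qed

text \<open>For small heights the cap of \<open>K\<close> contains a cap of the touching ball, on
  which the density is bounded below. Since no gap exceeds the diameter scale of \<open>K\<close>,
  rescaling the height extends the bound to all \<open>s\<close>, and
  \<open>1 - x \<le> exp (- x)\<close> gives the exponential form suited to products.\<close>

lemma cap_probability:
  fixes K :: "'a::euclidean_space set" and \<rho> :: "'a \<Rightarrow> real"
  defines "M \<equiv> density (lebesgue_on K) (\<lambda>x. ennreal (\<rho> x))"
  assumes K: "compact K" "K \<noteq> {}" and r: "0 < r" "rolls_freely_in (cball 0 r) K"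
    and \<rho>: "prob_density_on K \<rho>" "\<forall>p\<in>frontier K. 0 < \<rho> p \<and> continuous (at p within K) \<rho>"
  obtains c where "0 < c"
    "\<And>u s. norm u = 1 \<Longrightarrow> 0 \<le> s \<Longrightarrow>
      measure M {x \<in> K. s < support_fun K u - u \<bullet> x} \<le> exp (- c * s powr ((real DIM('a) + 1) / 2))"
proof -
  define d where "d = DIM('a)"
  define b where "b = (real d + 1) / 2"
  interpret M: prob_space M unfolding M_def by (rule prob_space_density_on[OF \<rho>(1)])
  have d: "1 \<le> real d" by (simp add: d_def Suc_leI)
  have bK: "bounded K" using K compact_imp_bounded by blast
  then obtain R where R: "0 < R" "\<And>x. x \<in> K \<Longrightarrow> norm x \<le> R" by (auto simp: bounded_pos)
  obtain \<epsilon> \<rho>0 where \<epsilon>: "0 < \<epsilon>" "0 < \<rho>0"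
    "\<And>x p. x \<in> K \<Longrightarrow> p \<in> frontier K \<Longrightarrow> dist x p < \<epsilon> \<Longrightarrow> \<rho>0 \<le> \<rho> x"
    by (rule density_bounded_below_near_frontier[OF K(1) \<rho>(2)]) blast
  \<comment> \<open>The first bound is the range of heights in \<open>ball_cap_volume\<close>. The
    second keeps the cap within \<open>\<epsilon>\<close> of \<open>p\<close>, the squared distance
    being at most \<open>2 * r * t\<close>.\<close>
  define t1 where "t1 = min (r / (8 * (real d)\<^sup>2)) (\<epsilon>\<^sup>2 / (4 * r))"
  define \<kappa> where "\<kappa> = (sqrt (r / 2) / (8 * (real d)\<^sup>2)) ^ (d - 1) / (2 * real d)"
  have t1: "0 < t1" using r \<epsilon> d by (simp add: t1_def)
  have \<kappa>: "0 < \<kappa>" using r d by (auto simp: \<kappa>_def)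
  have sp: "space M = K" by (simp add: M_def)
  have [measurable]: "{x \<in> K. s < support_fun K u - u \<bullet> x} \<in> sets M"
    "{x \<in> K. support_fun K u - u \<bullet> x \<le> s} \<in> sets M" for u s
  proof -
    have [measurable]: "(\<lambda>x. x) \<in> borel_measurable M" unfolding M_def by (rule ident_borel_measurable_density)
    have "{x \<in> space M. s < support_fun K u - u \<bullet> x} \<in> sets M"
      "{x \<in> space M. support_fun K u - u \<bullet> x \<le> s} \<in> sets M" by measurable
    then show "{x \<in> K. s < support_fun K u - u \<bullet> x} \<in> sets M"
      "{x \<in> K. support_fun K u - u \<bullet> x \<le> s} \<in> sets M" by (simp_all add: sp)
  qed
  have compl: "M.prob {x \<in> K. s < support_fun K u - u \<bullet> x} = 1 - M.prob {x \<in> K. support_fun K u - u \<bullet> x \<le> s}" for u s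
  proof -
    have "{x \<in> K. s < support_fun K u - u \<bullet> x} = space M - {x \<in> K. support_fun K u - u \<bullet> x \<le> s}"
      by (auto simp: sp)
    then show ?thesis by (simp add: M.prob_compl)
  qed
  have cap: "\<rho>0 * \<kappa> * t powr b \<le> M.prob {x \<in> K. support_fun K u - u \<bullet> x \<le> t}"
    if u: "norm u = 1" and t: "0 < t" "t \<le> t1" for u t
  proof -
    obtain p where p: "p \<in> frontier K" "u \<bullet> p = support_fun K u" "cball (p - r *\<^sub>R u) r \<subseteq> K"
      using rolls_freely_touching[OF K r(2) u] by metis
    define C where "C = {x \<in> cball (p - r *\<^sub>R u) r. u \<bullet> (p - x) \<le> t}"
    have C: "C \<subseteq> {x \<in> K. support_fun K u - u \<bullet> x \<le> t}"
      using p by (auto simp: C_def inner_diff_right)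
    have "C = cball (p - r *\<^sub>R u) r \<inter> {x. u \<bullet> (p - x) \<le> t}" by (auto simp: C_def)
    moreover have "closed {x. u \<bullet> (p - x) \<le> t}" by (intro closed_Collect_le continuous_intros)
    ultimately have Cm: "C \<in> sets lborel" by (auto intro!: borel_closed closed_Int)
    have Cl: "C \<in> sets (lebesgue_on K)"
      using C Cm by (auto simp: sets_restrict_space intro!: image_eqI[of _ _ C])
    have low: "\<rho>0 \<le> \<rho> x" if x: "x \<in> C" for x
    proof (rule \<epsilon>(3)[OF _ p(1)])
      show "x \<in> K" using x C by auto
      have "norm ((x - p) + r *\<^sub>R u) \<le> r"
        using x by (simp add: C_def dist_norm norm_minus_commute algebra_simps)
      then have "(norm ((x - p) + r *\<^sub>R u))\<^sup>2 \<le> r\<^sup>2" by (rule power_mono) simp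
      moreover have "(norm ((x - p) + r *\<^sub>R u))\<^sup>2 = (norm (x - p))\<^sup>2 - 2 * r * (u \<bullet> (p - x)) + r\<^sup>2"
        using u unfolding power2_norm_eq_inner norm_eq_1
        by (simp add: inner_simps inner_commute power2_eq_square algebra_simps)
      ultimately have "(norm (x - p))\<^sup>2 \<le> 2 * r * (u \<bullet> (p - x))" by linarith
      also have "\<dots> \<le> 2 * r * (\<epsilon>\<^sup>2 / (4 * r))"
        using x t r by (intro mult_left_mono) (auto simp: C_def t1_def)
      also have "\<dots> < \<epsilon>\<^sup>2" using r \<epsilon> by simp
      finally show "dist x p < \<epsilon>"
        using \<epsilon>(1) by (simp add: dist_norm power_less_imp_less_base)
    qed
    have "ennreal (\<kappa> * t powr b) \<le> emeasure lborel C"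
      using ball_cap_volume[OF u r(1) t(1), of p] t(2)
      by (simp add: \<kappa>_def b_def d_def C_def t1_def)
    then have "ennreal (\<rho>0 * \<kappa> * t powr b) \<le> ennreal \<rho>0 * emeasure lborel C"
      using \<epsilon> \<kappa> by (simp add: ennreal_mult mult.assoc mult_left_mono)
    also have "emeasure lborel C = emeasure (lebesgue_on K) C"
      using C Cm K(1) by (subst emeasure_restrict_space) (auto simp: compact_imp_closed borel_closed)
    also have "ennreal \<rho>0 * emeasure (lebesgue_on K) C = (\<integral>\<^sup>+x. ennreal \<rho>0 * indicator C x \<partial>lebesgue_on K)"
      using Cl by (simp add: nn_integral_cmult_indicator)
    also have "\<dots> \<le> (\<integral>\<^sup>+x. ennreal (\<rho> x) * indicator C x \<partial>lebesgue_on K)"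
      by (intro nn_integral_mono) (auto split: split_indicator intro!: ennreal_leI low)
    also have "\<dots> = emeasure M C"
      unfolding M_def using \<rho>(1) Cl by (subst emeasure_density) (auto simp: prob_density_on_def)
    also have "\<dots> \<le> emeasure M {x \<in> K. support_fun K u - u \<bullet> x \<le> t}"
      by (intro emeasure_mono C) measurable
    finally show ?thesis
      by (simp add: M.emeasure_eq_measure)
  qed
  \<comment> \<open>Gaps are at most \<open>2 * R\<close>, so the tail vanishes beyond
    \<open>Tm\<close>. The factor \<open>t1 / Tm\<close> maps heights up to \<open>Tm\<close> into
    the range where \<open>cap\<close> applies; its power is absorbed into \<open>c\<close>.\<close>
  define Tm where "Tm = 2 * R + t1"
  have Tm: "0 < Tm" "t1 \<le> Tm" using R t1 by (auto simp: Tm_def)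
  define c where "c = \<rho>0 * \<kappa> * (t1 / Tm) powr b"
  have "0 < c" using \<epsilon> \<kappa> t1 Tm by (simp add: c_def)
  moreover have "M.prob {x \<in> K. s < support_fun K u - u \<bullet> x} \<le> exp (- c * s powr b)"
    if u: "norm u = 1" and s: "0 \<le> s" for u s
  proof -
    consider "s = 0" | "Tm < s" | "0 < s" "s \<le> Tm" using s by linarith
    then show ?thesis
    proof cases
      case 1
      then show ?thesis by simp
    next
      case 2
      have "support_fun K u - u \<bullet> x \<le> s" if "x \<in> K" for x
      proof -
        have "support_fun K u \<le> R"
          unfolding support_fun_def
        proof (rule cSUP_least[OF K(2)])
          fix y assume "y \<in> K"
          then show "u \<bullet> y \<le> R" using norm_cauchy_schwarz[of u y] u R(2)[of y] by simp
        qed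
        moreover have "- (u \<bullet> x) \<le> R" using norm_cauchy_schwarz[of "- u" x] u R(2)[OF that] by simp
        ultimately show ?thesis using 2 t1 by (simp add: Tm_def)
      qed
      then have empty: "{x \<in> K. s < support_fun K u - u \<bullet> x} = {}" by fastforce
      show ?thesis unfolding empty by simp
    next
      case 3
      define t where "t = s * (t1 / Tm)"
      have t: "0 < t" "t \<le> t1" "t \<le> s"
        using 3 t1 Tm by (auto simp: t_def field_simps)
      have "M.prob {x \<in> K. s < support_fun K u - u \<bullet> x} \<le> M.prob {x \<in> K. t < support_fun K u - u \<bullet> x}"
        using t by (intro M.finite_measure_mono) auto
      also have "\<dots> \<le> 1 + (- (\<rho>0 * \<kappa> * t powr b))" using cap[OF u t(1,2)] compl[of t u] by simp
      also have "\<dots> = 1 + (- c * s powr b)"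
        using powr_mult[of s "t1 / Tm" b] 3 t1 Tm by (simp only: t_def c_def) (simp add: algebra_simps)
      also have "\<dots> \<le> exp (- c * s powr b)" by (rule exp_ge_add_one_self)
      finally show ?thesis .
    qed
  qed
  ultimately show ?thesis using that by (simp add: b_def d_def)
qed

section \<open>Moments from exponential tails\<close>

text \<open>A discrete layer-cake bound that reduces moments to tails at integers. With
  \<open>N\<close> the ceiling of \<open>x\<close>, \<open>x powr q\<close> is at most the square of
  \<open>N\<close>, and the sum has exactly \<open>N\<close> nonzero terms.\<close>

lemma powr_le_odd_sum:
  fixes x q :: real
  assumes "0 \<le> x" "0 < q" "q \<le> 2"
  shows "ennreal (x powr q) \<le> (\<Sum>j. ennreal (2 * real (Suc j)) * indicator {real j<..} x)"
proof -
  define N where "N = nat \<lceil>x\<rceil>"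
  have N: "x \<le> real N" "\<And>j. j < N \<Longrightarrow> real j < x"
    using assms by (auto simp: N_def) linarith+
  have "x powr q \<le> (real N)\<^sup>2"
  proof (cases "N = 0")
    case True
    then show ?thesis using N assms by simp
  next
    case False
    then have "x powr q \<le> real N powr q" using N assms by (intro powr_mono2) auto
    also have "\<dots> \<le> real N powr 2" using False assms by (intro powr_mono) auto
    finally show ?thesis using False by (simp add: powr_numeral)
  qed
  also have "(real N)\<^sup>2 \<le> (\<Sum>j<N. 2 * real (Suc j))"
    by (induction N) (auto simp: power2_eq_square algebra_simps)
  finally have "ennreal (x powr q) \<le> ennreal (\<Sum>j<N. 2 * real (Suc j))" by (rule ennreal_leI)
  also have "\<dots> = (\<Sum>j<N. ennreal (2 * real (Suc j)))" by (subst sum_ennreal) auto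
  also have "\<dots> = (\<Sum>j<N. ennreal (2 * real (Suc j)) * indicator {real j<..} x)"
    using N(2) by (intro sum.cong) auto
  also have "\<dots> \<le> (\<Sum>j. ennreal (2 * real (Suc j)) * indicator {real j<..} x)"
    by (rule sum_le_suminf) auto
  finally show ?thesis .
qed

text \<open>By independence, the probability that all gaps with index in \<open>J\<close> exceed
  \<open>s\<close> is the \<open>card J\<close>-th power of a single tail. Hence
  \<open>card J * m X powr b\<close> has a geometric tail with ratio \<open>exp (- c)\<close>,
  whatever the size of \<open>J\<close>.\<close>

lemma nn_moment_min_le:
  fixes T :: "'b \<Rightarrow> real" and m :: "('i \<Rightarrow> 'b) \<Rightarrow> real"
  assumes "prob_space M" and T: "T \<in> borel_measurable M"
    and c: "0 < c" and b: "0 < b" and q: "0 < q" "q \<le> 2"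
    and tail: "\<And>s. 0 \<le> s \<Longrightarrow> measure M {x \<in> space M. s < T x} \<le> exp (- c * s powr b)"
    and I: "finite I" "J \<subseteq> I" "J \<noteq> {}"
    and m: "m \<in> borel_measurable (PiM I (\<lambda>_. M))" "\<And>X. X \<in> space (PiM I (\<lambda>_. M)) \<Longrightarrow> 0 \<le> m X"
    and mT: "\<And>X j. X \<in> space (PiM I (\<lambda>_. M)) \<Longrightarrow> j \<in> J \<Longrightarrow> m X \<le> T (X j)"
  shows "(\<integral>\<^sup>+X. ennreal (m X powr (b * q)) \<partial>PiM I (\<lambda>_. M))
    \<le> ennreal (2 / (1 - exp (- c))\<^sup>2 * real (card J) powr (- q))"
proof -
  interpret M: prob_space M by fact
  interpret product_sigma_finite "\<lambda>_::'i. M"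
    by (intro product_sigma_finite.intro prob_space_imp_sigma_finite assms(1))
  let ?P = "PiM I (\<lambda>_. M)"
  interpret P: prob_space ?P by (intro prob_space_PiM assms(1))
  note [measurable] = T m(1)
  define k where "k = card J"
  have "finite J" using I finite_subset by blast
  then have k: "1 \<le> real k" using I by (simp add: k_def Suc_leI card_gt_0_iff)
  have tail': "emeasure ?P {X \<in> space ?P. s < m X} \<le> ennreal (exp (- c * s powr b) ^ k)" if s: "0 \<le> s" for s
  proof -
    \<comment> \<open>Coordinates outside \<open>J\<close> are left free and contribute the factor
      1.\<close>
    let ?A = "\<lambda>i. if i \<in> J then {x \<in> space M. s < T x} else space M"
    have A: "?A i \<in> sets M" for i by auto
    have "emeasure ?P {X \<in> space ?P. s < m X} \<le> emeasure ?P (PiE I ?A)"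
    proof (rule emeasure_mono)
      show "{X \<in> space ?P. s < m X} \<subseteq> PiE I ?A"
      proof
        fix X assume X: "X \<in> {X \<in> space ?P. s < m X}"
        then have "s < T (X j)" if "j \<in> J" for j using mT[of X j] that by auto
        then show "X \<in> PiE I ?A" using X by (auto simp: space_PiM PiE_def Pi_def)
      qed
      show "PiE I ?A \<in> sets ?P" using I A by (intro sets_PiM_I_finite) auto
    qed
    also have "\<dots> = (\<Prod>i\<in>I. emeasure M (?A i))" using I A by (intro emeasure_PiM) auto
    also have "\<dots> = (\<Prod>i\<in>J. emeasure M (?A i))"
      using I by (intro prod.mono_neutral_right) (auto simp: M.emeasure_space_1)
    also have "\<dots> = ennreal (M.prob {x \<in> space M. s < T x} ^ k)"
      by (simp add: k_def M.emeasure_eq_measure ennreal_power)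
    also have "\<dots> \<le> ennreal (exp (- c * s powr b) ^ k)"
      by (intro ennreal_leI power_mono tail s) simp
    finally show ?thesis .
  qed
  \<comment> \<open>The scaling that makes the tail independent of \<open>k\<close>; undoing it
    produces the factor \<open>k powr - q\<close>.\<close>
  define Z where "Z X = real k * m X powr b" for X
  have [measurable]: "Z \<in> borel_measurable ?P" unfolding Z_def by measurable
  have scale: "m X powr (b * q) = real k powr (- q) * Z X powr q" if "X \<in> space ?P" for X
    using k m(2)[OF that] by (simp add: Z_def powr_mult powr_powr powr_minus)
  have Zj: "emeasure ?P {X \<in> space ?P. real j < Z X} \<le> ennreal (exp (- c) ^ j)" for j
  proof -
    \<comment> \<open>The level at which the scaled variable equals \<open>j\<close>, that is
      \<open>k * s powr b = j\<close>.\<close>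
    define s where "s = (real j / real k) powr (1 / b)"
    have sb: "s powr b = real j / real k" using b by (simp add: s_def powr_powr)
    have "s < m X" if "X \<in> space ?P" "real j < Z X" for X
    proof (rule ccontr)
      assume "\<not> s < m X"
      then have "m X powr b \<le> s powr b" using b m(2)[OF that(1)] by (intro powr_mono2) auto
      then have "Z X \<le> real j" using k by (simp add: sb Z_def field_simps)
      then show False using that(2) by simp
    qed
    then have "emeasure ?P {X \<in> space ?P. real j < Z X} \<le> emeasure ?P {X \<in> space ?P. s < m X}"
      by (intro emeasure_mono) auto
    also have "\<dots> \<le> ennreal (exp (- c * s powr b) ^ k)" by (rule tail') (simp add: s_def)
    also have "exp (- c * s powr b) ^ k = exp (- c) ^ j"
      using k by (simp add: sb exp_of_nat_mult[symmetric])
    finally show ?thesis .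
  qed
  have "(\<integral>\<^sup>+X. ennreal (Z X powr q) \<partial>?P)
      \<le> (\<integral>\<^sup>+X. (\<Sum>j. ennreal (2 * real (Suc j)) * indicator {real j<..} (Z X)) \<partial>?P)"
    by (intro nn_integral_mono powr_le_odd_sum) (use q k in \<open>auto simp: Z_def\<close>)
  also have "\<dots> = (\<Sum>j. \<integral>\<^sup>+X. ennreal (2 * real (Suc j)) * indicator {real j<..} (Z X) \<partial>?P)"
    by (rule nn_integral_suminf) measurable
  also have "\<dots> \<le> (\<Sum>j. ennreal (2 * (real (Suc j) * exp (- c) ^ j)))"
  proof (intro suminf_le allI)
    fix j
    have "(\<integral>\<^sup>+X. ennreal (2 * real (Suc j)) * indicator {real j<..} (Z X) \<partial>?P)
        = (\<integral>\<^sup>+X. ennreal (2 * real (Suc j)) * indicator {X \<in> space ?P. real j < Z X} X \<partial>?P)"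
      by (intro nn_integral_cong) (auto split: split_indicator)
    also have "\<dots> = ennreal (2 * real (Suc j)) * emeasure ?P {X \<in> space ?P. real j < Z X}"
      by (intro nn_integral_cmult_indicator) measurable
    also have "\<dots> \<le> ennreal (2 * real (Suc j)) * ennreal (exp (- c) ^ j)"
      by (intro mult_left_mono Zj) auto
    also have "\<dots> = ennreal (2 * (real (Suc j) * exp (- c) ^ j))"
      by (subst ennreal_mult[symmetric]) (auto simp: mult.assoc)
    finally show "(\<integral>\<^sup>+X. ennreal (2 * real (Suc j)) * indicator {real j<..} (Z X) \<partial>?P)
      \<le> ennreal (2 * (real (Suc j) * exp (- c) ^ j))" .
  qed auto
  \<comment> \<open>The differentiated geometric series.\<close>
  also have "\<dots> = ennreal (2 * (1 / (1 - exp (- c))\<^sup>2))"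
  proof (rule suminf_ennreal_eq)
    show "(\<lambda>j. 2 * (real (Suc j) * exp (- c) ^ j)) sums (2 * (1 / (1 - exp (- c))\<^sup>2))"
      using geometric_deriv_sums[of "exp (- c)"] c by (intro sums_mult) simp
  qed simp
  finally have Zq: "(\<integral>\<^sup>+X. ennreal (Z X powr q) \<partial>?P) \<le> ennreal (2 / (1 - exp (- c))\<^sup>2)" by simp
  have "(\<integral>\<^sup>+X. ennreal (m X powr (b * q)) \<partial>?P)
      = (\<integral>\<^sup>+X. ennreal (real k powr (- q)) * ennreal (Z X powr q) \<partial>?P)"
    by (intro nn_integral_cong) (simp add: scale ennreal_mult)
  also have "\<dots> = ennreal (real k powr (- q)) * (\<integral>\<^sup>+X. ennreal (Z X powr q) \<partial>?P)"
    by (intro nn_integral_cmult) measurable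
  also have "\<dots> \<le> ennreal (real k powr (- q)) * ennreal (2 / (1 - exp (- c))\<^sup>2)"
    by (intro mult_left_mono Zq) auto
  also have "\<dots> = ennreal (2 / (1 - exp (- c))\<^sup>2 * real k powr (- q))"
    by (simp add: ennreal_mult[symmetric] mult.commute)
  finally show ?thesis by (simp add: k_def)
qed

section \<open>Deletion of a point\<close>

lemma support_fun_convex_hull:
  fixes A :: "'a::euclidean_space set"
  assumes "finite A" "A \<noteq> {}"
  shows "support_fun (convex hull A) u = Max ((\<lambda>x. u \<bullet> x) ` A)"
  unfolding support_fun_def
proof (rule cSup_eq_maximum)
  have "Max ((\<lambda>x. u \<bullet> x) ` A) \<in> (\<lambda>x. u \<bullet> x) ` A"
    using assms by (intro Max_in) auto
  then show "Max ((\<lambda>x. u \<bullet> x) ` A) \<in> (\<lambda>x. u \<bullet> x) ` (convex hull A)"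
    using hull_subset[of A convex] by auto
next
  fix y assume "y \<in> (\<lambda>x. u \<bullet> x) ` (convex hull A)"
  moreover have "convex hull A \<subseteq> {x. u \<bullet> x \<le> Max ((\<lambda>x. u \<bullet> x) ` A)}"
    using assms by (intro hull_minimal convex_halfspace_le) auto
  ultimately show "y \<le> Max ((\<lambda>x. u \<bullet> x) ` A)" by auto
qed

text \<open>\<open>D u * D v\<close> is at most the square of the larger of \<open>m u\<close>, \<open>m v\<close>; charging the pair to that
  direction leaves a cap for the other one.\<close>

lemma square_nn_integral_le:
  fixes N :: "'a::euclidean_space measure" and D m :: "'a \<Rightarrow> real"
  assumes sets: "sets N = sets borel" and "sigma_finite_measure N"
    and S: "AE u in N. norm u = 1"
    and C: "0 < C" "\<And>u \<rho>. 0 < \<rho> \<Longrightarrow> emeasure N (cball u \<rho>) \<le> ennreal (C * \<rho> ^ (DIM('a) - 1))"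
    and D: "D \<in> borel_measurable N" and m: "m \<in> borel_measurable N"
    and Dm: "\<And>u. 0 \<le> D u" "\<And>u. D u \<le> m u" and r: "0 < r"
    and close: "\<And>u v. norm u = 1 \<Longrightarrow> norm v = 1 \<Longrightarrow> 0 < D u \<Longrightarrow> 0 < D v \<Longrightarrow>
      dist u v \<le> sqrt (8 * max (m u) (m v) / r)"
  shows "(\<integral>\<^sup>+u. ennreal (D u) \<partial>N)\<^sup>2 \<le> ennreal (2 * (C * sqrt (8 / r) ^ (DIM('a) - 1))) *
    (\<integral>\<^sup>+u. ennreal (m u powr ((real DIM('a) + 3) / 2)) * indicator {u. 0 < D u} u \<partial>N)"
proof -
  interpret N: sigma_finite_measure N by fact
  interpret NN: pair_sigma_finite N N by unfold_locales
  note [measurable_cong] = sets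
  note [measurable] = D m
  have sp: "space N = UNIV" using sets_eq_imp_space_eq[OF sets] by simp
  define d where "d = DIM('a)"
  have d: "1 \<le> d" by (simp add: d_def Suc_leI)
  \<comment> \<open>The charge of the pair to its first argument. The cutoff is \<open>close\<close>
    with the maximum replaced by \<open>m u\<close>, as is right when
    \<open>m v \<le> m u\<close>.\<close>
  define E where "E u v = ennreal ((m u)\<^sup>2) * indicator {u. 0 < D u} u *
    indicator {(u, v). dist u v \<le> sqrt (8 * m u / r)} (u, v)" for u v
  have Em: "(\<lambda>(u, v). E u v) \<in> borel_measurable (N \<Otimes>\<^sub>M N)"
    unfolding E_def indicator_def by measurable
  have Em2: "(\<lambda>(u, v). E v u) \<in> borel_measurable (N \<Otimes>\<^sub>M N)"
    using measurable_compose[OF measurable_pair_swap' Em] by (simp add: case_prod_beta comp_def)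
  have Em1: "E u \<in> borel_measurable N" "(\<lambda>v. E v u) \<in> borel_measurable N" for u
    unfolding E_def indicator_def by measurable
  have DD: "ennreal (D u) * ennreal (D v) \<le> E u v + E v u" if uv: "norm u = 1" "norm v = 1" for u v
  proof (cases "0 < D u \<and> 0 < D v")
    case True
    then have pos: "0 < m u" "0 < m v" using Dm(2) by (meson less_le_trans)+
    have c: "dist u v \<le> sqrt (8 * max (m u) (m v) / r)" using close[OF uv] True by blast
    have le: "D u * D v \<le> m u * m v" using Dm pos by (intro mult_mono) auto
    show ?thesis
    proof (cases "m v \<le> m u")
      case mv: True
      have "D u * D v \<le> (m u)\<^sup>2"
        using le mult_left_mono[OF mv, of "m u"] pos unfolding power2_eq_square by linarith
      then have "ennreal (D u) * ennreal (D v) \<le> E u v"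
        using True c mv Dm(1) by (simp add: E_def ennreal_mult[symmetric] max_def ennreal_leI)
      then show ?thesis by (rule order_trans) simp
    next
      case False
      have "D u * D v \<le> (m v)\<^sup>2"
        using le mult_right_mono[of "m u" "m v" "m v"] False pos unfolding power2_eq_square by linarith
      then have "ennreal (D u) * ennreal (D v) \<le> E v u"
        using True c False Dm(1) by (simp add: E_def ennreal_mult[symmetric] max_def ennreal_leI dist_commute)
      then show ?thesis by (rule order_trans) simp
    qed
  next
    case False
    then have "D u = 0 \<or> D v = 0" using Dm(1) by (metis less_eq_real_def)
    then show ?thesis by auto
  qed
  have inner: "(\<integral>\<^sup>+v. E u v \<partial>N) \<le> ennreal (C * sqrt (8 / r) ^ (d - 1)) *
      (ennreal (m u powr ((real d + 3) / 2)) * indicator {u. 0 < D u} u)" for u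
  proof (cases "0 < D u")
    case True
    then have mu: "0 < m u" using Dm(2) by (meson less_le_trans)
    have "(\<integral>\<^sup>+v. E u v \<partial>N) = (\<integral>\<^sup>+v. ennreal ((m u)\<^sup>2) * indicator (cball u (sqrt (8 * m u / r))) v \<partial>N)"
      using True by (intro nn_integral_cong) (auto simp: E_def split: split_indicator)
    also have "\<dots> = ennreal ((m u)\<^sup>2) * emeasure N (cball u (sqrt (8 * m u / r)))"
      by (intro nn_integral_cmult_indicator) (simp add: sets)
    also have "\<dots> \<le> ennreal ((m u)\<^sup>2) * ennreal (C * sqrt (8 * m u / r) ^ (d - 1))"
      using mu r unfolding d_def by (intro mult_left_mono C) auto
    also have "\<dots> = ennreal (C * sqrt (8 / r) ^ (d - 1) * (m u powr ((real d + 3) / 2)))"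
    proof -
      \<comment> \<open>The cap of admissible \<open>v\<close> contributes
        \<open>sqrt (m u) ^ (d - 1)\<close> and the charge itself \<open>(m u)\<^sup>2\<close>,
        which together give the exponent \<open>(d + 3) / 2\<close>.\<close>
      have "m u powr ((real d + 3) / 2) = m u powr ((real d + 1) / 2 + 1)"
        by (simp add: field_simps)
      also have "\<dots> = sqrt (m u) ^ (d - 1) * (m u)\<^sup>2"
        using mu d by (simp only: powr_add powr_half_dim) (simp add: power2_eq_square)
      moreover have "sqrt (8 * m u / r) = sqrt (8 / r) * sqrt (m u)"
        by (simp flip: real_sqrt_mult)
      ultimately show ?thesis
        using mu C(1) r by (simp add: ennreal_mult[symmetric] power_mult_distrib algebra_simps)
    qed
    finally show ?thesis using True C(1) r by (simp add: ennreal_mult)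
  next
    case False
    then show ?thesis by (simp add: E_def)
  qed
  have "(\<integral>\<^sup>+u. ennreal (D u) \<partial>N)\<^sup>2 = (\<integral>\<^sup>+u. (\<integral>\<^sup>+v. ennreal (D u) * ennreal (D v) \<partial>N) \<partial>N)"
    by (simp add: nn_integral_cmult nn_integral_multc power2_eq_square)
  also have "\<dots> \<le> (\<integral>\<^sup>+u. (\<integral>\<^sup>+v. E u v + E v u \<partial>N) \<partial>N)"
  proof (rule nn_integral_mono_AE)
    have "(\<integral>\<^sup>+v. ennreal (D u) * ennreal (D v) \<partial>N) \<le> (\<integral>\<^sup>+v. E u v + E v u \<partial>N)" if "norm u = 1" for u
    proof (rule nn_integral_mono_AE)
      show "AE v in N. ennreal (D u) * ennreal (D v) \<le> E u v + E v u"
        using S by eventually_elim (rule DD[OF that])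
    qed
    then show "AE u in N. (\<integral>\<^sup>+v. ennreal (D u) * ennreal (D v) \<partial>N) \<le> (\<integral>\<^sup>+v. E u v + E v u \<partial>N)"
      using S by (auto elim: eventually_mono)
  qed
  also have "\<dots> = (\<integral>\<^sup>+u. (\<integral>\<^sup>+v. E u v \<partial>N) + (\<integral>\<^sup>+v. E v u \<partial>N) \<partial>N)"
    by (intro nn_integral_cong nn_integral_add Em1)
  also have "\<dots> = (\<integral>\<^sup>+u. (\<integral>\<^sup>+v. E u v \<partial>N) \<partial>N) + (\<integral>\<^sup>+u. (\<integral>\<^sup>+v. E v u \<partial>N) \<partial>N)"
    using N.borel_measurable_nn_integral[OF Em] N.borel_measurable_nn_integral[OF Em2]
    by (intro nn_integral_add) auto
  \<comment> \<open>The two charges have equal double integrals, whence the factor 2.\<close>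
  also have "(\<integral>\<^sup>+u. (\<integral>\<^sup>+v. E v u \<partial>N) \<partial>N) = (\<integral>\<^sup>+u. (\<integral>\<^sup>+v. E u v \<partial>N) \<partial>N)"
    by (rule NN.Fubini'[OF Em])
  also have "(\<integral>\<^sup>+u. (\<integral>\<^sup>+v. E u v \<partial>N) \<partial>N) + (\<integral>\<^sup>+u. (\<integral>\<^sup>+v. E u v \<partial>N) \<partial>N)
      = 2 * (\<integral>\<^sup>+u. (\<integral>\<^sup>+v. E u v \<partial>N) \<partial>N)"
    by (simp add: mult_2)
  also have "\<dots> \<le> 2 * (\<integral>\<^sup>+u. ennreal (C * sqrt (8 / r) ^ (d - 1)) *
      (ennreal (m u powr ((real d + 3) / 2)) * indicator {u. 0 < D u} u) \<partial>N)"
    by (intro mult_left_mono nn_integral_mono inner) auto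
  also have "\<dots> = 2 * (ennreal (C * sqrt (8 / r) ^ (d - 1)) *
      (\<integral>\<^sup>+u. ennreal (m u powr ((real d + 3) / 2)) * indicator {u. 0 < D u} u \<partial>N))"
    unfolding indicator_def by (subst nn_integral_cmult) auto
  also have "\<dots> = ennreal (2 * (C * sqrt (8 / r) ^ (d - 1))) *
      (\<integral>\<^sup>+u. ennreal (m u powr ((real d + 3) / 2)) * indicator {u. 0 < D u} u \<partial>N)"
    using C(1) r by (simp add: ennreal_mult mult.assoc)
  finally show ?thesis by (simp add: d_def)
qed

section \<open>Gaps of finite samples and their jumps\<close>

text \<open>The support function is Lipschitz, with any bound on the norms in \<open>K\<close> as
  constant.\<close>

lemma borel_measurable_support_fun:
  fixes K :: "'a::euclidean_space set"
  assumes "bounded K" "K \<noteq> {}"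
  shows "support_fun K \<in> borel_measurable borel"
proof -
  obtain R where R: "\<And>x. x \<in> K \<Longrightarrow> norm x \<le> R" using assms(1) by (auto simp: bounded_iff)
  have le: "support_fun K u \<le> support_fun K v + R * dist u v" for u v
    unfolding support_fun_def[of K u]
  proof (rule cSUP_least[OF assms(2)])
    fix x assume x: "x \<in> K"
    have "(u - v) \<bullet> x \<le> norm (u - v) * norm x" by (rule norm_cauchy_schwarz)
    also have "\<dots> \<le> norm (u - v) * R" using R[OF x] by (intro mult_left_mono) auto
    finally show "u \<bullet> x \<le> support_fun K v + R * dist u v"
      using inner_le_support_fun[OF assms(1) x, of v] by (simp add: inner_diff_left dist_norm mult.commute)
  qed
  have "0 \<le> R" using assms(2) R norm_ge_zero order_trans by blast
  moreover have "dist (support_fun K u) (support_fun K v) \<le> R * dist u v" for u v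
    using le[of u v] le[of v u] by (simp add: dist_real_def dist_commute abs_le_iff)
  ultimately have "R-lipschitz_on UNIV (support_fun K)"
    by (intro lipschitz_onI) auto
  then have "continuous_on UNIV (support_fun K)" by (rule lipschitz_on_continuous_on)
  then show ?thesis by (rule borel_measurable_continuous_onI)
qed

text \<open>The smallest gap among the points with index in \<open>J\<close>. Sets of indices rather
  than of points make deletion unambiguous even when points coincide.\<close>

definition support_gap :: "'a::euclidean_space set \<Rightarrow> 'i set \<Rightarrow> ('i \<Rightarrow> 'a) \<Rightarrow> 'a \<Rightarrow> real" where
  "support_gap K J X u = support_fun K u - Max ((\<lambda>j. u \<bullet> X j) ` J)"

lemma support_gap_nonneg:
  assumes "bounded K" "finite J" "J \<noteq> {}" "X ` J \<subseteq> K"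
  shows "0 \<le> support_gap K J X u"
  using assms by (auto simp: support_gap_def intro!: inner_le_support_fun)

lemma support_gap_le:
  assumes "finite J" "j \<in> J"
  shows "support_gap K J X u \<le> support_fun K u - u \<bullet> X j"
  using assms by (auto simp: support_gap_def)

lemma support_gap_antimono:
  assumes "finite J'" "J \<subseteq> J'" "J \<noteq> {}"
  shows "support_gap K J' X u \<le> support_gap K J X u"
  using assms by (auto simp: support_gap_def intro!: Max_mono)

text \<open>Deleting \<open>i\<close> can enlarge the gap only if \<open>X i\<close> strictly
  exceeds all other points in direction \<open>u\<close>.\<close>

lemma support_gap_jump:
  assumes "finite I" "i \<in> I" "I - {i} \<noteq> {}" and lt: "support_gap K I X u < support_gap K (I - {i}) X u"
  shows "support_fun K u - u \<bullet> X i < support_gap K (I - {i}) X u"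
    and "j \<in> I - {i} \<Longrightarrow> u \<bullet> X j < u \<bullet> X i"
proof -
  let ?M = "Max ((\<lambda>j. u \<bullet> X j) ` (I - {i}))"
  have "Max ((\<lambda>j. u \<bullet> X j) ` I) = max (u \<bullet> X i) ?M"
    using assms(1-3) by (subst insert_Diff[OF assms(2), symmetric], subst image_insert, subst Max_insert) auto
  then have M: "?M < u \<bullet> X i" using lt by (auto simp: support_gap_def max_def split: if_splits)
  then show "support_fun K u - u \<bullet> X i < support_gap K (I - {i}) X u" by (simp add: support_gap_def)
  show "u \<bullet> X j < u \<bullet> X i" if "j \<in> I - {i}"
  proof -
    have "u \<bullet> X j \<le> ?M" using assms(1) that by (intro Max_ge) auto
    then show ?thesis using M by simp
  qed
qed

text \<open>At most one point of the sample is the strict maximiser in direction \<open>u\<close>, and it misses one of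
  the two halves.\<close>

lemma sum_support_gap_le:
  assumes K: "bounded K" and I: "finite I" "X ` I \<subseteq> K"
    and J: "J1 \<union> J2 = I" "J1 \<inter> J2 = {}" "J1 \<noteq> {}" "J2 \<noteq> {}" and a: "0 \<le> a"
  shows "(\<Sum>i\<in>I. ennreal (support_gap K (I - {i}) X u powr a) *
      indicator {u. 0 < support_gap K (I - {i}) X u - support_gap K I X u} u)
    \<le> ennreal (support_gap K J1 X u powr a) + ennreal (support_gap K J2 X u powr a)"
    (is "(\<Sum>i\<in>I. ?t i) \<le> ?r")
proof (cases "\<exists>i\<in>I. support_gap K I X u < support_gap K (I - {i}) X u")
  case False
  then have "?t i = 0" if "i \<in> I" for i using that by auto
  then have "(\<Sum>i\<in>I. ?t i) = 0" by (intro sum.neutral) blast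
  then show ?thesis by (simp only: zero_le)
next
  case True
  then obtain i where i: "i \<in> I" "support_gap K I X u < support_gap K (I - {i}) X u" by blast
  have ne: "I - {k} \<noteq> {}" for k using J by blast
  have "?t k = 0" if "k \<in> I - {i}" for k
  proof -
    \<comment> \<open>Otherwise \<open>X i\<close> and \<open>X k\<close> would each lie strictly
      above the other in direction \<open>u\<close>.\<close>
    have "\<not> support_gap K I X u < support_gap K (I - {k}) X u"
      using support_gap_jump(2)[OF I(1) i(1) ne i(2), of k] that
        support_gap_jump(2)[OF I(1) _ ne, of k K X u i] i(1) by force
    then show ?thesis by simp
  qed
  then have "(\<Sum>k\<in>I - {i}. ?t k) = 0" by (intro sum.neutral) blast
  then have "(\<Sum>k\<in>I. ?t k) = ?t i"
    using sum.remove[OF I(1) i(1), of ?t] by (simp only: add_0_right)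
  also have "\<dots> \<le> ennreal (support_gap K (I - {i}) X u powr a)"
    by (auto split: split_indicator)
  also have "\<dots> \<le> ?r"
  proof -
    have *: "support_gap K (I - {i}) X u powr a \<le> support_gap K J' X u powr a"
      if "J' \<subseteq> I - {i}" "J' \<noteq> {}" for J'
      using that I ne a
      by (intro powr_mono2 support_gap_nonneg[OF K] support_gap_antimono) auto
    consider "J1 \<subseteq> I - {i}" | "J2 \<subseteq> I - {i}" using J(1,2) by blast
    then show ?thesis
    proof cases
      case 1
      then have "ennreal (support_gap K (I - {i}) X u powr a) \<le> ennreal (support_gap K J1 X u powr a)"
        using * J by (intro ennreal_leI) auto
      then show ?thesis by (rule order_trans) simp
    next
      case 2
      then have "ennreal (support_gap K (I - {i}) X u powr a) \<le> ennreal (support_gap K J2 X u powr a)"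
        using * J by (intro ennreal_leI) auto
      then show ?thesis by (rule order_trans) simp
    qed
  qed
  finally show ?thesis .
qed

section \<open>Integration over the directions\<close>

lemma abs_Max_inner_le:
  assumes "\<And>x. x \<in> K \<Longrightarrow> norm x \<le> R" "finite J" "J \<noteq> {}" "X ` J \<subseteq> K" "norm u = 1"
  shows "\<bar>Max ((\<lambda>j. u \<bullet> X j) ` J)\<bar> \<le> R"
proof -
  have "Max ((\<lambda>j. u \<bullet> X j) ` J) \<in> (\<lambda>j. u \<bullet> X j) ` J" using assms by (intro Max_in) auto
  then obtain j where "j \<in> J" "Max ((\<lambda>j. u \<bullet> X j) ` J) = u \<bullet> X j" by auto
  then show ?thesis
    using assms(1)[of "X j"] assms(4,5) Cauchy_Schwarz_ineq2[of u "X j"] by (auto simp: image_subset_iff)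
qed

lemma Max_inner_measurable:
  assumes "finite J"
  shows "(\<lambda>u. Max ((\<lambda>j. u \<bullet> X j) ` J)) \<in> borel_measurable (borel :: 'a::euclidean_space measure)"
  using assms by (intro borel_measurable_Max) auto

lemma integrable_Max_inner:
  fixes N :: "'a::euclidean_space measure"
  assumes "sets N = sets borel" "finite_measure N" "AE u in N. norm u = 1"
    and "\<And>x. x \<in> K \<Longrightarrow> norm x \<le> R" "finite J" "J \<noteq> {}" "X ` J \<subseteq> K"
  shows "integrable N (\<lambda>u. Max ((\<lambda>j. u \<bullet> X j) ` J))"
    and "\<bar>\<integral>u. Max ((\<lambda>j. u \<bullet> X j) ` J) \<partial>N\<bar> \<le> R * measure N (space N)"
proof -
  interpret N: finite_measure N by fact
  have AE: "AE u in N. \<bar>Max ((\<lambda>j. u \<bullet> X j) ` J)\<bar> \<le> R"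
    using assms(3) by eventually_elim (rule abs_Max_inner_le[OF assms(4-7)])
  show int: "integrable N (\<lambda>u. Max ((\<lambda>j. u \<bullet> X j) ` J))"
  proof (rule N.integrable_const_bound[where B=R])
    show "(\<lambda>u. Max ((\<lambda>j. u \<bullet> X j) ` J)) \<in> borel_measurable N"
      using Max_inner_measurable[OF assms(5)] by (subst measurable_cong_sets[OF assms(1) refl])
  qed (use AE in simp)
  have "\<bar>\<integral>u. Max ((\<lambda>j. u \<bullet> X j) ` J) \<partial>N\<bar> \<le> (\<integral>u. \<bar>Max ((\<lambda>j. u \<bullet> X j) ` J)\<bar> \<partial>N)" by simp
  also have "\<dots> \<le> (\<integral>u. R \<partial>N)" by (intro integral_mono_AE) (use int AE in auto)
  finally show "\<bar>\<integral>u. Max ((\<lambda>j. u \<bullet> X j) ` J) \<partial>N\<bar> \<le> R * measure N (space N)"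
    by (simp add: mult.commute)
qed

text \<open>The deterministic core, valid for every sample in \<open>K\<close> and every split into
  nonempty parts. Each square is handled by \<open>square_nn_integral_le\<close>; the sum over
  \<open>i\<close> is moved inside the integral, where \<open>sum_support_gap_le\<close> applies.
  The bound no longer depends on \<open>i\<close>.\<close>

lemma sum_jackknife_squares_le:
  fixes K :: "'a::euclidean_space set" and N :: "'a measure" and X :: "'i \<Rightarrow> 'a"
  defines "a \<equiv> (real DIM('a) + 3) / 2"
  assumes K: "compact K" "convex K" and r: "0 < r" "rolls_freely_in (cball 0 r) K"
    and N: "sets N = sets borel" "finite_measure N" "AE u in N. norm u = 1"
    and C: "0 < C" "\<And>u \<rho>. 0 < \<rho> \<Longrightarrow> emeasure N (cball u \<rho>) \<le> ennreal (C * \<rho> ^ (DIM('a) - 1))"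
    and I: "finite I" "X ` I \<subseteq> K"
    and J: "J1 \<union> J2 = I" "J1 \<inter> J2 = {}" "J1 \<noteq> {}" "J2 \<noteq> {}"
  shows "(\<Sum>i\<in>I. ennreal (((\<integral>u. Max ((\<lambda>j. u \<bullet> X j) ` I) \<partial>N) - (\<integral>u. Max ((\<lambda>j. u \<bullet> X j) ` (I - {i})) \<partial>N))\<^sup>2))
    \<le> ennreal (2 * (C * sqrt (8 / r) ^ (DIM('a) - 1))) *
      (\<integral>\<^sup>+u. ennreal (support_gap K J1 X u powr a) + ennreal (support_gap K J2 X u powr a) \<partial>N)"
proof -
  interpret N: finite_measure N by fact
  have bK: "bounded K" using K(1) by (rule compact_imp_bounded)
  then obtain R where R: "\<And>x. x \<in> K \<Longrightarrow> norm x \<le> R" by (auto simp: bounded_iff)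
  have ne: "I - {i} \<noteq> {}" "I \<noteq> {}" for i using J by blast+
  have K0: "K \<noteq> {}" using I(2) ne(2) by blast
  let ?c = "ennreal (2 * (C * sqrt (8 / r) ^ (DIM('a) - 1)))"
  let ?g = "\<lambda>i u. support_gap K (I - {i}) X u"
  let ?D = "\<lambda>i u. ?g i u - support_gap K I X u"
  have gm: "(\<lambda>u. support_gap K J X u) \<in> borel_measurable N" if "finite J" for J
    unfolding support_gap_def
    using borel_measurable_support_fun[OF bK K0] Max_inner_measurable[OF that]
    by (subst measurable_cong_sets[OF N(1) refl]) (rule borel_measurable_diff)
  have D_eq: "?D i u = Max ((\<lambda>j. u \<bullet> X j) ` I) - Max ((\<lambda>j. u \<bullet> X j) ` (I - {i}))" for i u
    by (simp add: support_gap_def)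
  have "ennreal (((\<integral>u. Max ((\<lambda>j. u \<bullet> X j) ` I) \<partial>N) - (\<integral>u. Max ((\<lambda>j. u \<bullet> X j) ` (I - {i})) \<partial>N))\<^sup>2)
      \<le> ?c * (\<integral>\<^sup>+u. ennreal (?g i u powr a) * indicator {u. 0 < ?D i u} u \<partial>N)" if i: "i \<in> I" for i
  proof -
    have D0: "0 \<le> ?D i u" for u using support_gap_antimono[OF I(1) _ ne(1)] by simp
    have Dg: "?D i u \<le> ?g i u" for u using support_gap_nonneg[OF bK I(1) ne(2) I(2)] by simp
    have int: "integrable N (\<lambda>u. Max ((\<lambda>j. u \<bullet> X j) ` I))" "integrable N (\<lambda>u. Max ((\<lambda>j. u \<bullet> X j) ` (I - {i})))"
      using I ne by (auto intro!: integrable_Max_inner(1)[OF N R])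
    have "ennreal (((\<integral>u. Max ((\<lambda>j. u \<bullet> X j) ` I) \<partial>N) - (\<integral>u. Max ((\<lambda>j. u \<bullet> X j) ` (I - {i})) \<partial>N))\<^sup>2)
        = ennreal ((\<integral>u. ?D i u \<partial>N)\<^sup>2)"
      using int by (simp add: D_eq)
    also have "\<dots> = (ennreal (\<integral>u. ?D i u \<partial>N))\<^sup>2"
      using D0 by (simp add: ennreal_power integral_nonneg_AE)
    also have "ennreal (\<integral>u. ?D i u \<partial>N) = (\<integral>\<^sup>+u. ennreal (?D i u) \<partial>N)"
      using D0 int by (intro nn_integral_eq_integral[symmetric]) (auto simp: D_eq)
    also have "(\<integral>\<^sup>+u. ennreal (?D i u) \<partial>N)\<^sup>2 \<le> ?c * (\<integral>\<^sup>+u. ennreal (?g i u powr a) * indicator {u. 0 < ?D i u} u \<partial>N)"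
      unfolding a_def
    proof (rule square_nn_integral_le[OF N(1) _ N(3) C _ _ D0 Dg r(1)])
      show "sigma_finite_measure N" by unfold_locales
      show "?g i \<in> borel_measurable N" using I(1) by (intro gm) auto
      then show "?D i \<in> borel_measurable N" using gm[OF I(1)] by (rule borel_measurable_diff)
      fix u v :: 'a
      assume u: "norm u = 1" "0 < ?D i u" and v: "norm v = 1" "0 < ?D i v"
      have "X i \<in> K" using i I(2) by blast
      then obtain w where w: "norm w \<le> r" "\<And>u. norm u = 1 \<Longrightarrow> r - u \<bullet> w \<le> support_fun K u - u \<bullet> X i"
        using rolls_freely_slack[OF K r(2)] r(1) by (metis less_imp_le)
      \<comment> \<open>Where deletion of \<open>i\<close> causes a jump, the gap of
        \<open>X i\<close> is below that of the other points. With \<open>w\<close> fixed by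
        \<open>X i\<close>, all such directions are therefore near \<open>w / r\<close>.\<close>
      have *: "r - x \<bullet> w \<le> ?g i x" if "norm x = 1" "0 < ?D i x" for x
        using support_gap_jump(1)[OF I(1) i ne(1), of K X x] w(2)[OF that(1)] that(2) by linarith
      show "dist u v \<le> sqrt (8 * max (?g i u) (?g i v) / r)"
        using *[OF u] *[OF v] by (intro directions_close[OF r(1) w(1) u(1) v(1)]) auto
    qed
    finally show ?thesis .
  qed
  then have "(\<Sum>i\<in>I. ennreal (((\<integral>u. Max ((\<lambda>j. u \<bullet> X j) ` I) \<partial>N) - (\<integral>u. Max ((\<lambda>j. u \<bullet> X j) ` (I - {i})) \<partial>N))\<^sup>2))
      \<le> (\<Sum>i\<in>I. ?c * (\<integral>\<^sup>+u. ennreal (?g i u powr a) * indicator {u. 0 < ?D i u} u \<partial>N))"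
    by (intro sum_mono)
  also have "\<dots> = ?c * (\<Sum>i\<in>I. \<integral>\<^sup>+u. ennreal (?g i u powr a) * indicator {u. 0 < ?D i u} u \<partial>N)"
    by (rule sum_distrib_left[symmetric])
  also have "(\<Sum>i\<in>I. \<integral>\<^sup>+u. ennreal (?g i u powr a) * indicator {u. 0 < ?D i u} u \<partial>N)
      = (\<integral>\<^sup>+u. (\<Sum>i\<in>I. ennreal (?g i u powr a) * indicator {u. 0 < ?D i u} u) \<partial>N)"
  proof (rule nn_integral_sum[symmetric])
    fix i
    have [measurable]: "?g i \<in> borel_measurable N" "support_gap K I X \<in> borel_measurable N"
      using I(1) by (auto intro!: gm)
    show "(\<lambda>u. ennreal (?g i u powr a) * indicator {u. 0 < ?D i u} u) \<in> borel_measurable N"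
      unfolding indicator_def by measurable
  qed
  also have "\<dots> \<le> (\<integral>\<^sup>+u. ennreal (support_gap K J1 X u powr a) + ennreal (support_gap K J2 X u powr a) \<partial>N)"
    by (intro nn_integral_mono sum_support_gap_le bK I J) (simp add: a_def)
  finally show ?thesis by (simp add: mult_left_mono)
qed

section \<open>Mean width of the random polytope and the variance bound\<close>

lemma mean_width_convex_hull_finite:
  fixes N :: "'a::euclidean_space measure"
  assumes "\<And>f. f \<in> borel_measurable borel \<Longrightarrow>
      (LINT u:sphere 0 1|hausdorff_measure (DIM('a) - 1). f u :: real) = (\<integral>u. f u \<partial>N)"
    and "finite J" "J \<noteq> {}"
  shows "mean_width (convex hull (X ` J)) =
    2 / (real DIM('a) * unit_ball_vol (real DIM('a))) * (\<integral>u. Max ((\<lambda>j. u \<bullet> X j) ` J) \<partial>N)"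
  using assms Max_inner_measurable[OF assms(2), of X]
  by (simp add: mean_width_def support_fun_convex_hull image_image)

theorem theorem1p5:
  fixes K :: "'a::euclidean_space set" and \<rho> :: "'a \<Rightarrow> real"
  assumes "DIM('a) \<ge> 2"
    and "convex_body K"
    and "0 \<in> interior K"
    and "\<exists>r>0. rolls_freely_in (cball 0 r) K"
    and "prob_density_on K \<rho>"
    and "\<forall>p\<in>frontier K. 0 < \<rho> p \<and> continuous (at p within K) \<rho>"
  shows "\<exists>c>0. \<forall>n\<ge>1.
           prob_space.variance (iid_points K \<rho> n) (\<lambda>X. mean_width (random_polytope n X))
             \<le> c * real n powr (- ((real DIM('a) + 3) / (real DIM('a) + 1)))"
proof -
  have K: "compact K" "convex K" "K \<noteq> {}"
    using assms(2) interior_subset by (auto simp: convex_body_def)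
  have bK: "bounded K" using K(1) by (rule compact_imp_bounded)
  obtain r where r: "0 < r" "rolls_freely_in (cball 0 r) K" using assms(4) by blast
  obtain R where R: "0 < R" "\<And>x. x \<in> K \<Longrightarrow> norm x \<le> R" using bK by (auto simp: bounded_pos)
  define d where "d = real DIM('a)"
  have d: "2 \<le> d" using assms(1) by (simp add: d_def)
  \<comment> \<open>\<open>b\<close> is the exponent in the cap probability and \<open>a\<close> the
    power of the gap in the jackknife bound. Since \<open>a = b * q\<close>, the moment of order
    \<open>a\<close> of the smallest of \<open>k\<close> gaps is of order \<open>k powr - q\<close>,
    which is the required rate.\<close>
  define b q a where "b = (d + 1) / 2" and "q = (d + 3) / (d + 1)" and "a = (d + 3) / 2"
  have bq: "b * q = a" "0 < b" "0 < q" "q \<le> 2"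
    using d by (auto simp: b_def q_def a_def field_simps)
  obtain N :: "'a measure" and C where C: "0 < C" and N: "sets N = sets borel" "finite_measure N"
    "AE u in N. norm u = 1"
    and cap: "\<And>u \<rho>. 0 < \<rho> \<Longrightarrow> emeasure N (cball u \<rho>) \<le> ennreal (C * \<rho> ^ (DIM('a) - 1))"
    and LN: "\<And>f. f \<in> borel_measurable borel \<Longrightarrow>
      (LINT u:sphere 0 1|hausdorff_measure (DIM('a) - 1). f u :: real) = (\<integral>u. f u \<partial>N)"
    by (rule normalised_sphere_measure) blast
  interpret N: finite_measure N by fact
  define M where "M = density (lebesgue_on K) (\<lambda>x. ennreal (\<rho> x))"
  have PM: "prob_space M" unfolding M_def by (rule prob_space_density_on[OF assms(5)])
  interpret M: prob_space M by (rule PM)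
  have spM: "space M = K" by (simp add: M_def)
  obtain c where c: "0 < c" "\<And>u s. norm u = 1 \<Longrightarrow> 0 \<le> s \<Longrightarrow>
      M.prob {x \<in> space M. s < support_fun K u - u \<bullet> x} \<le> exp (- c * s powr b)"
    by (rule cap_probability[OF K(1,3) r assms(5,6)]) (auto simp: M_def b_def d_def)
  define w where "w = 2 / (d * unit_ball_vol d)"
  have w: "0 \<le> w" using d by (simp add: w_def)
  define A where "A = 2 / (1 - exp (- c))\<^sup>2"
  have A: "0 < A" using c by (simp add: A_def)
  define B where "B = w * (R * measure N (space N))"
  have B: "0 \<le> B" using w R by (simp add: B_def)
  define Q where "Q = w\<^sup>2 * (2 * (C * sqrt (8 / r) ^ (DIM('a) - 1)))"
  have Q: "0 \<le> Q" using C r by (simp add: Q_def)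
  \<comment> \<open>The 2 counts the two halves, \<open>3 powr q\<close> arises because each half
    has at least \<open>n / 3\<close> points, and the last factor is the total mass of the
    directions.\<close>
  define c0 where "c0 = Q * (2 * A * 3 powr q * measure N (space N))"
  have c0: "0 \<le> c0" using Q A by (simp add: c0_def)
  \<comment> \<open>In the constant, the square of \<open>B\<close> serves \<open>n = 1\<close>,
    \<open>c0\<close> serves larger \<open>n\<close>, and the 1 ensures positivity.\<close>
  have var: "prob_space.variance (iid_points K \<rho> n) (\<lambda>X. mean_width (random_polytope n X))
      \<le> (B\<^sup>2 + c0 + 1) * real n powr - q" if n: "1 \<le> n" for n
  proof -
    let ?I = "{..<n}"
    let ?P = "PiM ?I (\<lambda>_. M)"
    interpret P: prob_space ?P by (intro prob_space_PiM PM)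
    have iid: "iid_points K \<rho> n = ?P" by (simp add: iid_points_def M_def)
    have I0: "?I \<noteq> {}" using n by (simp add: lessThan_empty_iff)
    note [measurable_cong] = N(1)
    have XK: "X ` J \<subseteq> K" if "X \<in> space ?P" "J \<subseteq> ?I" for X J
      using that by (auto simp: space_PiM spM)
    have Xm: "(\<lambda>X. X j) \<in> borel_measurable ?P" if "j < n" for j
    proof -
      have "(\<lambda>X. X j) \<in> measurable ?P M" using that by (intro measurable_component_singleton) auto
      then show ?thesis
        using measurable_compose[OF _ ident_borel_measurable_density[of K "\<lambda>x. ennreal (\<rho> x)", folded M_def]]
        by blast
    qed
    have Maxm: "(\<lambda>(X, u). Max ((\<lambda>j. u \<bullet> X j) ` J)) \<in> borel_measurable (?P \<Otimes>\<^sub>M N)" if "J \<subseteq> ?I" for J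
    proof -
      have "(\<lambda>p. snd p \<bullet> fst p j) \<in> borel_measurable (?P \<Otimes>\<^sub>M N)" if "j \<in> J" for j
      proof -
        have [measurable]: "(\<lambda>X. X j) \<in> borel_measurable ?P" using that \<open>J \<subseteq> ?I\<close> by (intro Xm) auto
        show ?thesis by measurable
      qed
      then show ?thesis
        using that finite_subset[OF that] unfolding case_prod_beta by (intro borel_measurable_Max) auto
    qed
    define W where "W J X = w * (\<integral>u. Max ((\<lambda>j. u \<bullet> X j) ` J) \<partial>N)" for J and X :: "nat \<Rightarrow> 'a"
    have Wm: "W J \<in> borel_measurable ?P" if "J \<subseteq> ?I" for J
      unfolding W_def using N.borel_measurable_lebesgue_integral[OF Maxm[OF that]] by simp
    have WB: "\<bar>W J X\<bar> \<le> B" if "X \<in> space ?P" "J \<subseteq> ?I" "J \<noteq> {}" for X J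
    proof -
      have "\<bar>\<integral>u. Max ((\<lambda>j. u \<bullet> X j) ` J) \<partial>N\<bar> \<le> R * measure N (space N)"
        using that XK[OF that(1,2)] finite_subset[OF that(2)]
        by (intro integrable_Max_inner(2)[OF N R(2)]) auto
      then show ?thesis unfolding W_def B_def using w by (simp add: abs_mult mult_left_mono)
    qed
    have f_eq: "mean_width (random_polytope n X) = W ?I X" for X
      unfolding random_polytope_def W_def w_def d_def
      using I0 by (intro mean_width_convex_hull_finite LN) auto
    have "P.variance (W ?I) \<le> (B\<^sup>2 + c0 + 1) * real n powr - q"
    proof (cases "n = 1")
      case True
      \<comment> \<open>Deleting the only point would leave a maximum over the empty set, so this
        case uses the uniform bound on \<open>W\<close> instead of the jackknife.\<close>
      have "P.variance (W ?I) \<le> P.expectation (\<lambda>X. (W ?I X)\<^sup>2)"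
        using P.integral_square_deviation[OF Wm WB, of ?I "P.expectation (W ?I)"] I0 by simp
      also have "\<dots> \<le> P.expectation (\<lambda>X. B\<^sup>2)"
      proof (rule integral_mono)
        show le: "(W ?I X)\<^sup>2 \<le> B\<^sup>2" if "X \<in> space ?P" for X
          using power_mono[OF WB[OF that, of ?I], of 2] I0 by simp
        show "integrable ?P (\<lambda>X. (W ?I X)\<^sup>2)"
          using Wm[of ?I] le by (intro P.integrable_bounded[where B="B\<^sup>2"]) auto
      qed simp
      also have "\<dots> = B\<^sup>2" by (simp add: P.prob_space)
      finally show ?thesis using True c0 by simp
    next
      case False
      then have n2: "2 \<le> n" using n by simp
      define J1 J2 where "J1 = {..<n div 2}" and "J2 = {n div 2..<n}"
      have J: "J1 \<union> J2 = ?I" "J1 \<inter> J2 = {}" "J1 \<noteq> {}" "J2 \<noteq> {}" "J1 \<subseteq> ?I" "J2 \<subseteq> ?I"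
        using n2 by (auto simp: J1_def J2_def lessThan_empty_iff)
      have cardJ: "real n / 3 \<le> real (card J1)" "real n / 3 \<le> real (card J2)"
      proof -
        \<comment> \<open>The worst case is \<open>n = 3\<close>, where the smaller half has exactly
          one third of the points.\<close>
        have "n \<le> 3 * (n div 2)" "n div 2 \<le> n - n div 2" using n2 by presburger+
        then have "real n \<le> real (3 * (n div 2))" "real (n div 2) \<le> real (n - n div 2)"
          unfolding of_nat_le_iff .
        then show "real n / 3 \<le> real (card J1)" "real n / 3 \<le> real (card J2)"
          unfolding J1_def J2_def card_lessThan card_atLeastLessThan by simp_all
      qed
      have ne: "?I - {i} \<noteq> {}" for i using J by blast
      have gapm [measurable]: "(\<lambda>(X, u). support_gap K J X u) \<in> borel_measurable (?P \<Otimes>\<^sub>M N)" if "J \<subseteq> ?I" for J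
      proof -
        have [measurable]: "support_fun K \<in> borel_measurable borel"
          by (rule borel_measurable_support_fun[OF bK K(3)])
        have "(\<lambda>p. support_fun K (snd p)) \<in> borel_measurable (?P \<Otimes>\<^sub>M N)" by measurable
        then show ?thesis
          using Maxm[OF that] unfolding support_gap_def case_prod_beta by (rule borel_measurable_diff)
      qed
      have moment: "(\<integral>\<^sup>+X. ennreal (support_gap K J X u powr a) \<partial>?P) \<le> ennreal (A * 3 powr q * real n powr - q)"
        if u: "norm u = 1" and J: "J \<subseteq> ?I" "J \<noteq> {}" "real n / 3 \<le> real (card J)" for u J
      proof -
        have fJ: "finite J" using J(1) finite_subset by blast
        have "(\<integral>\<^sup>+X. ennreal (support_gap K J X u powr (b * q)) \<partial>?P) \<le> ennreal (A * real (card J) powr - q)"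
          unfolding A_def
        proof (rule nn_moment_min_le[OF PM _ c(1) bq(2-4) c(2)[OF u] _ J(1,2)])
          have [measurable]: "(\<lambda>x. x) \<in> borel_measurable M"
            unfolding M_def by (rule ident_borel_measurable_density)
          show "(\<lambda>x. support_fun K u - u \<bullet> x) \<in> borel_measurable M" by measurable
          have "(\<lambda>X. (X, u)) \<in> measurable ?P (?P \<Otimes>\<^sub>M N)"
            using sets_eq_imp_space_eq[OF N(1)] by (intro measurable_Pair2') simp
          from measurable_compose[OF this gapm[OF J(1)]]
          show "(\<lambda>X. support_gap K J X u) \<in> borel_measurable ?P" by simp
          show "0 \<le> support_gap K J X u" if "X \<in> space ?P" for X
            by (rule support_gap_nonneg[OF bK fJ J(2) XK[OF that J(1)]])
          show "support_gap K J X u \<le> support_fun K u - u \<bullet> X j" if "j \<in> J" for X j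
            by (rule support_gap_le[OF fJ that])
        qed auto
        also have "real (card J) powr - q \<le> (real n / 3) powr - q"
          using J(3) n bq by (intro powr_mono2') auto
        also have "(real n / 3) powr - q = 3 powr q * real n powr - q"
          by (simp add: powr_divide powr_minus field_simps)
        finally show ?thesis using A by (simp add: bq(1) mult.assoc ennreal_leI mult_left_mono)
      qed
      interpret PN: pair_sigma_finite ?P N by unfold_locales
      have fg: "integrable ?P (\<lambda>X. (W ?I X - W (?I - {i}) X)\<^sup>2)" for i
      proof (rule P.integrable_bounded[where B="(2 * B)\<^sup>2"])
        show "(\<lambda>X. (W ?I X - W (?I - {i}) X)\<^sup>2) \<in> borel_measurable ?P"
          using Wm[of ?I] Wm[of "?I - {i}"] by measurable
        fix X assume X: "X \<in> space ?P"
        have "\<bar>W ?I X - W (?I - {i}) X\<bar> \<le> 2 * B"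
          using WB[OF X, of ?I] WB[OF X _ ne, of i] I0 by fastforce
        then show "\<bar>(W ?I X - W (?I - {i}) X)\<^sup>2\<bar> \<le> (2 * B)\<^sup>2"
          using power_mono[of "\<bar>W ?I X - W (?I - {i}) X\<bar>" "2 * B" 2] by simp
      qed
      let ?G = "\<lambda>X u. ennreal (support_gap K J1 X u powr a) + ennreal (support_gap K J2 X u powr a)"
      have Gm: "(\<lambda>(X, u). ?G X u) \<in> borel_measurable (?P \<Otimes>\<^sub>M N)"
        using gapm[OF J(5)] gapm[OF J(6)] unfolding case_prod_beta by measurable
      \<comment> \<open>Efron--Stein with \<open>g i\<close> the scaled integral for the sample
        without its \<open>i\<close>-th point.\<close>
      have "P.variance (W ?I) \<le> (\<Sum>i\<in>?I. \<integral>X. (W ?I X - W (?I - {i}) X)\<^sup>2 \<partial>?P)"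
      proof (rule efron_stein[where B=B])
        show "W (?I - {i}) (X(i := y)) = W (?I - {i}) X" for i X y
        proof -
          have "(\<lambda>j. u \<bullet> (X(i := y)) j) ` (?I - {i}) = (\<lambda>j. u \<bullet> X j) ` (?I - {i})" for u
            by (intro image_cong) auto
          then show ?thesis by (simp only: W_def)
        qed
      qed (use PM Wm WB I0 ne in auto)
      then have "ennreal (P.variance (W ?I)) \<le> ennreal (\<Sum>i\<in>?I. \<integral>X. (W ?I X - W (?I - {i}) X)\<^sup>2 \<partial>?P)"
        by (rule ennreal_leI)
      also have "\<dots> = (\<Sum>i\<in>?I. \<integral>\<^sup>+X. ennreal ((W ?I X - W (?I - {i}) X)\<^sup>2) \<partial>?P)"
        using fg by (subst sum_ennreal[symmetric]) (auto simp: nn_integral_eq_integral)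
      also have "\<dots> = (\<integral>\<^sup>+X. (\<Sum>i\<in>?I. ennreal ((W ?I X - W (?I - {i}) X)\<^sup>2)) \<partial>?P)"
        using fg by (intro nn_integral_sum[symmetric]) (auto dest: borel_measurable_integrable)
      also have "\<dots> \<le> (\<integral>\<^sup>+X. ennreal Q * (\<integral>\<^sup>+u. ?G X u \<partial>N) \<partial>?P)"
      proof (rule nn_integral_mono)
        fix X assume X: "X \<in> space ?P"
        have "(\<Sum>i\<in>?I. ennreal ((W ?I X - W (?I - {i}) X)\<^sup>2)) = ennreal (w\<^sup>2) *
          (\<Sum>i\<in>?I. ennreal (((\<integral>u. Max ((\<lambda>j. u \<bullet> X j) ` ?I) \<partial>N) - (\<integral>u. Max ((\<lambda>j. u \<bullet> X j) ` (?I - {i})) \<partial>N))\<^sup>2))"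
          unfolding sum_distrib_left
          by (intro sum.cong refl)
             (simp add: W_def ennreal_mult[symmetric] power_mult_distrib flip: right_diff_distrib)
        also have "\<dots> \<le> ennreal (w\<^sup>2) * (ennreal (2 * (C * sqrt (8 / r) ^ (DIM('a) - 1))) * (\<integral>\<^sup>+u. ?G X u \<partial>N))"
          unfolding a_def d_def
          by (intro mult_left_mono sum_jackknife_squares_le K r N C cap J XK[OF X]) auto
        also have "\<dots> = ennreal Q * (\<integral>\<^sup>+u. ?G X u \<partial>N)"
          using C r by (simp add: Q_def ennreal_mult mult.assoc)
        finally show "(\<Sum>i\<in>?I. ennreal ((W ?I X - W (?I - {i}) X)\<^sup>2)) \<le> ennreal Q * (\<integral>\<^sup>+u. ?G X u \<partial>N)" .
      qed
      also have "\<dots> = ennreal Q * (\<integral>\<^sup>+X. (\<integral>\<^sup>+u. ?G X u \<partial>N) \<partial>?P)"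
        by (rule nn_integral_cmult) (rule N.borel_measurable_nn_integral[OF Gm])
      \<comment> \<open>Exchanging the integrals lets the moment bound be applied for each fixed
        direction, uniformly over the sphere.\<close>
      also have "(\<integral>\<^sup>+X. (\<integral>\<^sup>+u. ?G X u \<partial>N) \<partial>?P) = (\<integral>\<^sup>+u. (\<integral>\<^sup>+X. ?G X u \<partial>?P) \<partial>N)"
        by (rule PN.Fubini'[OF Gm, symmetric])
      also have "\<dots> \<le> (\<integral>\<^sup>+u. ennreal (2 * A * 3 powr q * real n powr - q) \<partial>N)"
        using N(3)
      proof (rule nn_integral_mono_AE[OF eventually_mono])
        fix u :: 'a assume u: "norm u = 1"
        have sm: "(\<lambda>X. ennreal (support_gap K J X u powr a)) \<in> borel_measurable ?P" if "J \<subseteq> ?I" for J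
        proof -
          have "(\<lambda>X. (X, u)) \<in> measurable ?P (?P \<Otimes>\<^sub>M N)"
            using sets_eq_imp_space_eq[OF N(1)] by (intro measurable_Pair2') simp
          from measurable_compose[OF this gapm[OF that]]
          have [measurable]: "(\<lambda>X. support_gap K J X u) \<in> borel_measurable ?P" by simp
          show ?thesis by measurable
        qed
        have "(\<integral>\<^sup>+X. ?G X u \<partial>?P) = (\<integral>\<^sup>+X. ennreal (support_gap K J1 X u powr a) \<partial>?P)
            + (\<integral>\<^sup>+X. ennreal (support_gap K J2 X u powr a) \<partial>?P)"
          by (intro nn_integral_add sm J)
        also have "\<dots> \<le> ennreal (A * 3 powr q * real n powr - q) + ennreal (A * 3 powr q * real n powr - q)"
          by (intro add_mono moment u J cardJ)
        also have "\<dots> = ennreal (2 * A * 3 powr q * real n powr - q)"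
          using A by (simp flip: ennreal_plus)
        finally show "(\<integral>\<^sup>+X. ?G X u \<partial>?P) \<le> ennreal (2 * A * 3 powr q * real n powr - q)" .
      qed
      also have "ennreal Q * \<dots> = ennreal (c0 * real n powr - q)"
        using A Q by (simp add: N.emeasure_eq_measure ennreal_mult[symmetric] c0_def algebra_simps)
      finally have "P.variance (W ?I) \<le> c0 * real n powr - q"
        using c0 by (simp add: mult_left_mono)
      also have "\<dots> \<le> (B\<^sup>2 + c0 + 1) * real n powr - q"
        by (intro mult_right_mono) auto
      finally show ?thesis .
    qed
    then show ?thesis by (simp only: iid f_eq)
  qed
  have "0 < B\<^sup>2 + c0 + 1" using c0 zero_le_power2[of B] by linarith
  then show ?thesis using var unfolding q_def d_def by blast
qed

end
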